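(* Let $A$ be a random variable with values in $\mathcal{A}=\{0,1\}$, $X$ a random variable with values in a set $\mathcal{X}$, and $Y$ a random variable with values in a finite set $\mathcal{Y}$, jointly distributed with $(X,A)$. Let $h:\Delta_{\mathcal{Y}}\to\mathbb{R}$ be continuous and concave. Let $f^*:\mathcal{X}\times\mathcal{A}\to\Delta_{\mathcal{Y}}$ be the Bayes optimal classifier, $f^*(x,a)=\mathbb{P}(Y=\cdot\mid X=x,A=a)$, and let $X'=f^*(X,A)$, a random variable with values in $\Delta_{\mathcal{Y}}$. Then for any representation $Z$ of $(X,A)$ there is a representation $Z'$ of $(X',A)$ such that $$\mathbb{E}_{z'\sim Z'}\, h(\mathbb{P}(Y\mid Z'=z'))\le \mathbb{E}_{z\sim Z}\, h(\mathbb{P}(Y\mid Z=z))\quad\text{and}\quad D_{TV}(Z')\le D_{TV}(Z).$$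
   Context: $\Delta_{\mathcal{Y}}$ is the set of probability distributions on the finite set $\mathcal{Y}$. A representation $Z$ of $(X,A)$ is a random variable with values in some space $\mathcal{Z}$, specified through a conditional distribution $\mathbb{P}(Z\mid X,A)$, and such that conditioned on $(X,A)$, $Z$ is independent of the other variables of the problem; in particular $Z\perp Y\mid (X,A)$. A representation of $(X',A)$ is defined in the same way with $(X',A)$ in place of $(X,A)$. $\mathbb{P}(Y\mid Z=z)\in\Delta_{\mathcal{Y}}$ denotes the conditional distribution of $Y$ given $Z=z$. For a representation $Z$, $\mu_a=\mathbb{P}(Z=\cdot\mid A=a)$ for $a\in\{0,1\}$ (both values of $A$ have positive probability), and $D_{TV}(Z)=\|\mu_0-\mu_1\|_{TV}$, where the total variation distance is normalized as half the $L_1$ distance: for $\mu,\nu$ with densities $f_\mu,f_\nu$ with respect to a common reference measure, $\|\mu-\nu\|_{TV}=\frac12\int|f_\mu-f_\nu|$; on a discrete set, $\|\mu-\nu\|_{TV}=\frac12\sum_z|\mu(z)-\nu(z)|$. *)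

theory Defs
  imports "HOL-Probability.Probability"
begin

definition prob_simplex :: "(real ^ 'y::finite) set" where
  "prob_simplex = {p. (\<forall>y. 0 \<le> p $ y) \<and> (\<Sum>y\<in>UNIV. p $ y) = 1}"

text \<open>
  \<open>cond_dist M N V Y p\<close>: the function \<open>p\<close> is a version of the conditional distribution
  \<open>v \<mapsto> P(Y = \<cdot> | V = v)\<close> under \<open>M\<close>, where \<open>V\<close> takes values in the measurable space \<open>N\<close>.
  Versions are determined up to null sets of the law of \<open>V\<close>.
\<close>

definition cond_dist ::
    "'m measure \<Rightarrow> 'v measure \<Rightarrow> ('m \<Rightarrow> 'v) \<Rightarrow> ('m \<Rightarrow> 'y::finite) \<Rightarrow> ('v \<Rightarrow> real ^ 'y) \<Rightarrow> bool" where
  "cond_dist M N V Y p \<longleftrightarrow>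
     p \<in> N \<rightarrow>\<^sub>M restrict_space borel prob_simplex \<and>
     (\<forall>y. \<forall>B\<in>sets N. measure M {\<omega>\<in>space M. V \<omega> \<in> B \<and> Y \<omega> = y}
                       = (LINT v:B|distr M N V. p v $ y))"

text \<open>
  A representation \<open>Z\<close> of a random variable with values in \<open>MV\<close> is specified by the Markov kernel
  \<open>v \<mapsto> P(Z | V = v)\<close> from \<open>MV\<close> to the space \<open>N\<close> of values of \<open>Z\<close>.
\<close>

definition representation :: "'v measure \<Rightarrow> 'z measure \<Rightarrow> ('v \<Rightarrow> 'z measure) \<Rightarrow> bool" where
  "representation MV N K \<longleftrightarrow> K \<in> MV \<rightarrow>\<^sub>M prob_algebra N"

text \<open>
  The extension of the probability space \<open>M\<close> by \<open>Z \<sim> K (V \<omega>)\<close>. On \<open>extend M V N K\<close> the representation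
  is the random variable \<open>snd\<close>, a random variable \<open>W\<close> on \<open>M\<close> becomes \<open>W \<circ> fst\<close>, and conditionally
  on \<open>V\<close>, \<open>Z\<close> is independent of all of \<open>M\<close>.
\<close>

definition extend ::
    "'m measure \<Rightarrow> ('m \<Rightarrow> 'v) \<Rightarrow> 'z measure \<Rightarrow> ('v \<Rightarrow> 'z measure) \<Rightarrow> ('m \<times> 'z) measure" where
  "extend M V N K = M \<bind> (\<lambda>\<omega>. distr (K (V \<omega>)) (M \<Otimes>\<^sub>M N) (\<lambda>z. (\<omega>, z)))"

text \<open>
  Half the \<open>L\<^sub>1\<close> distance of the densities with respect to the common reference measure \<open>\<mu> + \<nu>\<close>; by
  \<open>tv_dist_density\<close> below any other common reference measure gives the same value.
\<close>

definition sum_meas :: "'z measure \<Rightarrow> 'z measure \<Rightarrow> 'z measure" where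
  "sum_meas \<mu> \<nu> = measure_of (space \<mu>) (sets \<mu>) (\<lambda>B. emeasure \<mu> B + emeasure \<nu> B)"

definition tv_dist :: "'z measure \<Rightarrow> 'z measure \<Rightarrow> real" where
  "tv_dist \<mu> \<nu> = (let \<rho> = sum_meas \<mu> \<nu> in
     1/2 * (\<integral>z. \<bar>enn2real (RN_deriv \<rho> \<mu> z) - enn2real (RN_deriv \<rho> \<nu> z)\<bar> \<partial>\<rho>))"

definition cond_law :: "'m measure \<Rightarrow> 'z measure \<Rightarrow> ('m \<Rightarrow> 'z) \<Rightarrow> ('m \<Rightarrow> nat) \<Rightarrow> nat \<Rightarrow> 'z measure" where
  "cond_law M N Z A a = distr (uniform_measure M {\<omega>\<in>space M. A \<omega> = a}) N Z"

definition D_TV :: "'m measure \<Rightarrow> 'z measure \<Rightarrow> ('m \<Rightarrow> 'z) \<Rightarrow> ('m \<Rightarrow> nat) \<Rightarrow> real" where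
  "D_TV M N Z A = tv_dist (cond_law M N Z A 0) (cond_law M N Z A 1)"

lemma
  assumes "prob_space M" and V[measurable]: "V \<in> M \<rightarrow>\<^sub>M MV" and K: "representation MV N K"
  shows prob_space_extend: "prob_space (extend M V N K)"
    and sets_extend: "sets (extend M V N K) = sets (M \<Otimes>\<^sub>M N)"
    and emeasure_extend: "\<And>B C. B \<in> sets M \<Longrightarrow> C \<in> sets N \<Longrightarrow>
      emeasure (extend M V N K) (B \<times> C) = (\<integral>\<^sup>+\<omega>. emeasure (K (V \<omega>)) C * indicator B \<omega> \<partial>M)"
proof -
  interpret M: prob_space M by fact
  have K'[measurable]: "K \<in> MV \<rightarrow>\<^sub>M prob_algebra N" using K by (simp add: representation_def)
  define k where "k \<omega> = distr (K (V \<omega>)) (M \<Otimes>\<^sub>M N) (\<lambda>z. (\<omega>, z))" for \<omega>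
  have k: "k \<in> M \<rightarrow>\<^sub>M prob_algebra (M \<Otimes>\<^sub>M N)"
    unfolding k_def by (rule measurable_distr_prob_space2[where M = N]) measurable
  have ne: "space M \<noteq> {}" by (rule M.not_empty)
  have M: "M \<in> space (prob_algebra M)" by (simp add: space_prob_algebra assms(1))
  have e: "extend M V N K = M \<bind> k" by (simp add: extend_def k_def[abs_def])
  show "prob_space (extend M V N K)" unfolding e using prob_space_bind'[OF M k] .
  show "sets (extend M V N K) = sets (M \<Otimes>\<^sub>M N)" unfolding e using sets_bind'[OF M k] .
  fix B C assume B[measurable]: "B \<in> sets M" and C[measurable]: "C \<in> sets N"
  have "emeasure (extend M V N K) (B \<times> C) = (\<integral>\<^sup>+\<omega>. emeasure (k \<omega>) (B \<times> C) \<partial>M)"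
    unfolding e by (rule emeasure_bind[OF ne measurable_prob_algebraD[OF k]]) measurable
  also have "\<dots> = (\<integral>\<^sup>+\<omega>. emeasure (K (V \<omega>)) C * indicator B \<omega> \<partial>M)"
  proof (rule nn_integral_cong)
    fix \<omega> assume \<omega>: "\<omega> \<in> space M"
    have "K (V \<omega>) \<in> space (prob_algebra N)"
      using \<omega> measurable_space[OF K'] measurable_space[OF V] by blast
    then have s[measurable_cong]: "sets (K (V \<omega>)) = sets N" by (simp add: space_prob_algebra)
    have "emeasure (k \<omega>) (B \<times> C) = emeasure (K (V \<omega>)) ((\<lambda>z. (\<omega>, z)) -` (B \<times> C) \<inter> space (K (V \<omega>)))"
      unfolding k_def using \<omega> by (intro emeasure_distr) measurable
    also have "(\<lambda>z. (\<omega>, z)) -` (B \<times> C) \<inter> space (K (V \<omega>)) = (if \<omega> \<in> B then C else {})"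
      using sets.sets_into_space[OF C] sets_eq_imp_space_eq[OF s] by auto
    finally show "emeasure (k \<omega>) (B \<times> C) = emeasure (K (V \<omega>)) C * indicator B \<omega>" by simp
  qed
  finally show "emeasure (extend M V N K) (B \<times> C) = (\<integral>\<^sup>+\<omega>. emeasure (K (V \<omega>)) C * indicator B \<omega> \<partial>M)" .
qed

lemma space_sum_meas [simp]: "space (sum_meas \<mu> \<nu>) = space \<mu>"
  and sets_sum_meas [simp, measurable_cong]: "sets (sum_meas \<mu> \<nu>) = sets \<mu>"
  by (simp_all add: sum_meas_def)

lemma emeasure_sum_meas:
  assumes "sets \<nu> = sets \<mu>" "B \<in> sets \<mu>"
  shows "emeasure (sum_meas \<mu> \<nu>) B = emeasure \<mu> B + emeasure \<nu> B"
proof (rule emeasure_measure_of[OF sum_meas_def])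
  show "sets \<mu> \<subseteq> Pow (space \<mu>)" by (rule sets.space_closed)
  show "B \<in> sets (sum_meas \<mu> \<nu>)" using assms by simp
  show "positive (sets (sum_meas \<mu> \<nu>)) (\<lambda>B. emeasure \<mu> B + emeasure \<nu> B)"
    by (simp add: positive_def)
  show "countably_additive (sets (sum_meas \<mu> \<nu>)) (\<lambda>B. emeasure \<mu> B + emeasure \<nu> B)"
  proof (rule countably_additiveI)
    fix F :: "nat \<Rightarrow> _" assume F: "range F \<subseteq> sets (sum_meas \<mu> \<nu>)" "disjoint_family F"
    have F1: "range F \<subseteq> sets \<mu>" and F2: "range F \<subseteq> sets \<nu>" using F assms(1) by simp_all
    have "(\<Sum>i. emeasure \<mu> (F i) + emeasure \<nu> (F i)) = (\<Sum>i. emeasure \<mu> (F i)) + (\<Sum>i. emeasure \<nu> (F i))"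
      by (intro suminf_add[symmetric]) auto
    then show "(\<Sum>i. emeasure \<mu> (F i) + emeasure \<nu> (F i)) = emeasure \<mu> (\<Union> (range F)) + emeasure \<nu> (\<Union> (range F))"
      using suminf_emeasure[OF F1 F(2)] suminf_emeasure[OF F2 F(2)] by simp
  qed
qed

lemma tv_dist_density:
  fixes f g :: "'z \<Rightarrow> real"
  assumes L: "sigma_finite_measure L"
    and f[measurable]: "f \<in> borel_measurable L" and g[measurable]: "g \<in> borel_measurable L"
    and f0: "\<And>z. 0 \<le> f z" and g0: "\<And>z. 0 \<le> g z"
    and \<mu>: "\<mu> = density L (\<lambda>z. ennreal (f z))" and \<nu>: "\<nu> = density L (\<lambda>z. ennreal (g z))"
    and "prob_space \<mu>" "prob_space \<nu>"
  shows "tv_dist \<mu> \<nu> = 1/2 * (\<integral>z. \<bar>f z - g z\<bar> \<partial>L)"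
proof -
  interpret L: sigma_finite_measure L by fact
  interpret m: prob_space \<mu> by fact
  interpret n: prob_space \<nu> by fact
  define S where "S = sum_meas \<mu> \<nu>"
  have sets[simp]: "sets \<mu> = sets L" "sets \<nu> = sets L" by (simp_all add: \<mu> \<nu>)
  have setsS[simp, measurable_cong]: "sets S = sets L" by (simp add: S_def)
  have S: "S = density L (\<lambda>z. ennreal (f z + g z))"
  proof (rule measure_eqI)
    fix B assume "B \<in> sets S"
    then have B[measurable]: "B \<in> sets L" by simp
    have "emeasure S B = emeasure \<mu> B + emeasure \<nu> B"
      unfolding S_def by (rule emeasure_sum_meas) auto
    also have "\<dots> = (\<integral>\<^sup>+z. ennreal (f z) * indicator B z + ennreal (g z) * indicator B z \<partial>L)"
      unfolding \<mu> \<nu> by (simp add: emeasure_density nn_integral_add)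
    also have "\<dots> = emeasure (density L (\<lambda>z. ennreal (f z + g z))) B"
      by (simp add: emeasure_density ennreal_plus[OF f0 g0] distrib_right del: ennreal_plus)
    finally show "emeasure S B = emeasure (density L (\<lambda>z. ennreal (f z + g z))) B" .
  qed simp
  have fin: "finite_measure S"
  proof (rule finite_measureI)
    have "space S = space L" using setsS by (rule sets_eq_imp_space_eq)
    then have "emeasure S (space S) = emeasure \<mu> (space L) + emeasure \<nu> (space L)"
      unfolding S_def by (subst emeasure_sum_meas) auto
    then show "emeasure S (space S) \<noteq> \<infinity>" by auto
  qed
  then interpret S: finite_measure S .
  have key: "AE z in L. u z = (f z + g z) * enn2real (RN_deriv S W z)"
    if u[measurable]: "u \<in> borel_measurable L" and u0: "\<And>z. 0 \<le> u z"
      and W: "W = density L (\<lambda>z. ennreal (u z))" and le: "\<And>z. u z \<le> f z + g z"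
      and "prob_space W" for u W
  proof -
    interpret W: prob_space W by fact
    have ac: "absolutely_continuous S W"
      unfolding absolutely_continuous_def null_sets_def
    proof safe
      fix B assume B: "B \<in> sets S" "emeasure S B = 0"
      then have [measurable]: "B \<in> sets L" by simp
      have "emeasure W B \<le> emeasure S B"
        unfolding S W by (auto simp: emeasure_density intro!: nn_integral_mono mult_right_mono ennreal_leI le)
      with B show "emeasure W B = 0" by simp
      show "B \<in> sets W" using B by (simp add: W)
    qed
    have sW: "sets W = sets S" by (simp add: W)
    have "density S (RN_deriv S W) = W" by (rule S.density_RN_deriv[OF ac sW])
    moreover have [measurable]: "RN_deriv S W \<in> borel_measurable L"
      using borel_measurable_RN_deriv[of S W] measurable_cong_sets[OF setsS refl] by blast
    ultimately have "density L (\<lambda>z. ennreal (f z + g z) * RN_deriv S W z) = density L (\<lambda>z. ennreal (u z))"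
      unfolding W[symmetric] by (subst (asm) (1) S) (simp add: density_density_eq)
    then have "AE z in L. ennreal (f z + g z) * RN_deriv S W z = ennreal (u z)"
      by (intro L.density_unique) auto
    then show ?thesis
    proof eventually_elim
      case (elim z)
      then have "enn2real (ennreal (f z + g z) * RN_deriv S W z) = u z" using u0 by simp
      then show ?case using f0 g0 by (simp add: enn2real_mult add_nonneg_nonneg del: ennreal_plus)
    qed
  qed
  define r s where "r z = enn2real (RN_deriv S \<mu> z)" and "s z = enn2real (RN_deriv S \<nu> z)" for z
  have [measurable]: "r \<in> borel_measurable L" "s \<in> borel_measurable L"
    unfolding r_def s_def measurable_cong_sets[OF setsS[symmetric] refl] by measurable
  have "tv_dist \<mu> \<nu> = 1/2 * (\<integral>z. \<bar>r z - s z\<bar> \<partial>S)"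
    by (simp add: tv_dist_def Let_def S_def r_def s_def)
  also have "(\<integral>z. \<bar>r z - s z\<bar> \<partial>S) = (\<integral>z. (f z + g z) * \<bar>r z - s z\<bar> \<partial>L)"
    unfolding S using f0 g0 by (subst integral_density) (auto simp: add_nonneg_nonneg)
  also have "\<dots> = (\<integral>z. \<bar>f z - g z\<bar> \<partial>L)"
  proof (rule integral_cong_AE)
    have "AE z in L. f z = (f z + g z) * r z" "AE z in L. g z = (f z + g z) * s z"
      unfolding r_def s_def using assms by (auto intro!: key)
    then show "AE z in L. (f z + g z) * \<bar>r z - s z\<bar> = \<bar>f z - g z\<bar>"
    proof eventually_elim
      case (elim z)
      have "(f z + g z) * \<bar>r z - s z\<bar> = \<bar>(f z + g z) * r z - (f z + g z) * s z\<bar>"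
        using f0[of z] g0[of z] by (simp add: abs_mult right_diff_distrib[symmetric])
      then show ?case using elim by simp
    qed
  qed auto
  finally show ?thesis .
qed

text \<open>The conditional distributions exist without assumptions on the space of values of \<open>V\<close>.\<close>

lemma cond_dist_exists:
  fixes V :: "'m \<Rightarrow> 'v" and Y :: "'m \<Rightarrow> 'y::finite"
  assumes "prob_space M" and V[measurable]: "V \<in> M \<rightarrow>\<^sub>M N" and Y[measurable]: "Y \<in> M \<rightarrow>\<^sub>M count_space UNIV"
  shows "\<exists>p. cond_dist M N V Y p"
proof -
  interpret M: prob_space M by fact
  define D where "D = distr M N V"
  interpret D: prob_space D unfolding D_def by (rule M.prob_space_distr) fact
  have sD[simp, measurable_cong]: "sets D = sets N" by (simp add: D_def)
  define W where "W y = distr (density M (indicator {\<omega>\<in>space M. Y \<omega> = y})) N V" for y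
  have eW: "emeasure (W y) B = emeasure M {\<omega>\<in>space M. V \<omega> \<in> B \<and> Y \<omega> = y}" if [measurable]: "B \<in> sets N" for y B
  proof -
    have "emeasure (W y) B = (\<integral>\<^sup>+\<omega>. indicator {\<omega>\<in>space M. Y \<omega> = y} \<omega> * indicator (V -` B \<inter> space M) \<omega> \<partial>M)"
      unfolding W_def by (subst emeasure_distr) (auto simp: emeasure_density)
    also have "\<dots> = (\<integral>\<^sup>+\<omega>. indicator {\<omega>\<in>space M. V \<omega> \<in> B \<and> Y \<omega> = y} \<omega> \<partial>M)"
      by (intro nn_integral_cong) (auto split: split_indicator)
    finally show ?thesis by simp
  qed
  have sW: "sets (W y) = sets D" for y by (simp add: W_def)
  have ac: "absolutely_continuous D (W y)" for y
    unfolding absolutely_continuous_def null_sets_def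
  proof safe
    fix B assume B: "B \<in> sets D" "emeasure D B = 0"
    then have [measurable]: "B \<in> sets N" by simp
    have "emeasure (W y) B \<le> emeasure D B"
      by (auto simp: eW D_def emeasure_distr intro!: emeasure_mono)
    with B show "emeasure (W y) B = 0" by simp
    show "B \<in> sets (W y)" using B by (simp add: sW)
  qed
  define r where "r y = RN_deriv D (W y)" for y
  have [measurable]: "r y \<in> borel_measurable N" for y
    unfolding r_def measurable_cong_sets[OF sD[symmetric] refl] by measurable
  have er: "emeasure M {\<omega>\<in>space M. V \<omega> \<in> B \<and> Y \<omega> = y} = (\<integral>\<^sup>+v. r y v * indicator B v \<partial>D)"
    if B[measurable]: "B \<in> sets N" for y B
  proof -
    have "density D (r y) = W y" unfolding r_def by (rule D.density_RN_deriv[OF ac sW])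
    then have "emeasure (W y) B = emeasure (density D (r y)) B" by simp
    then show ?thesis using eW[OF B, of y] by (simp add: emeasure_density)
  qed
  have sum1: "AE v in D. (\<Sum>y\<in>UNIV. r y v) = 1"
  proof -
    have "density D (\<lambda>v. \<Sum>y\<in>UNIV. r y v) = density D (\<lambda>_. 1)"
    proof (rule measure_eqI)
      fix B assume "B \<in> sets (density D (\<lambda>v. \<Sum>y\<in>UNIV. r y v))"
      then have [measurable]: "B \<in> sets N" by simp
      have "emeasure (density D (\<lambda>v. \<Sum>y\<in>UNIV. r y v)) B = (\<Sum>y\<in>UNIV. \<integral>\<^sup>+v. r y v * indicator B v \<partial>D)"
        by (simp add: emeasure_density sum_distrib_right nn_integral_sum del: sum_mult_indicator)
      also have "\<dots> = (\<Sum>y\<in>UNIV. emeasure M {\<omega>\<in>space M. V \<omega> \<in> B \<and> Y \<omega> = y})"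
        by (simp add: er)
      also have "\<dots> = emeasure M (\<Union>y\<in>UNIV. {\<omega>\<in>space M. V \<omega> \<in> B \<and> Y \<omega> = y})"
        by (rule sum_emeasure) (auto simp: disjoint_family_on_def)
      also have "(\<Union>y\<in>UNIV. {\<omega>\<in>space M. V \<omega> \<in> B \<and> Y \<omega> = y}) = V -` B \<inter> space M" by auto
      also have "emeasure M \<dots> = emeasure (density D (\<lambda>_. 1)) B"
        by (simp add: emeasure_density D_def emeasure_distr)
      finally show "emeasure (density D (\<lambda>v. \<Sum>y\<in>UNIV. r y v)) B = emeasure (density D (\<lambda>_. 1)) B" .
    qed simp
    then show ?thesis by (intro D.density_unique) auto
  qed
  define G where "G = {v \<in> space N. (\<Sum>y\<in>UNIV. r y v) = 1}"
  have G[measurable]: "G \<in> sets N" unfolding G_def by measurable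
  define p :: "'v \<Rightarrow> real ^ 'y" where
    "p v = (\<chi> y. if v \<in> G then enn2real (r y v) else 1 / real CARD('y))" for v
  have rfin: "r y v \<noteq> \<top>" if "v \<in> G" for y v
  proof
    assume top: "r y v = \<top>"
    have "r y v \<le> (\<Sum>y\<in>UNIV. r y v)" by (rule member_le_sum) auto
    also have "\<dots> = 1" using that unfolding G_def by blast
    finally show False using top by (simp add: top_unique)
  qed
  have pm: "p \<in> N \<rightarrow>\<^sub>M borel"
    by (subst borel_measurable_euclidean_space) (auto simp: Basis_vec_def inner_axis p_def)
  have "p v \<in> prob_simplex" for v
  proof (cases "v \<in> G")
    case True
    have "ennreal (\<Sum>y\<in>UNIV. enn2real (r y v)) = (\<Sum>y\<in>UNIV. ennreal (enn2real (r y v)))"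
      by (simp add: sum_ennreal)
    also have "\<dots> = (\<Sum>y\<in>UNIV. r y v)"
      using rfin[OF True] by (intro sum.cong refl) (simp add: less_top)
    also have "\<dots> = 1" using True by (simp add: G_def)
    finally have "(\<Sum>y\<in>UNIV. enn2real (r y v)) = 1" by simp
    then show ?thesis using True by (simp add: p_def prob_simplex_def)
  qed (simp add: p_def prob_simplex_def)
  then have "p \<in> N \<rightarrow>\<^sub>M restrict_space borel prob_simplex"
    by (intro measurable_restrict_space2 pm) auto
  moreover have "measure M {\<omega>\<in>space M. V \<omega> \<in> B \<and> Y \<omega> = y} = (LINT v:B|distr M N V. p v $ y)"
    if B[measurable]: "B \<in> sets N" for y B
  proof -
    have AEG: "AE v in D. v \<in> G"
      using sum1 AE_space by eventually_elim (simp add: G_def D_def)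
    have [measurable]: "(\<lambda>v. p v $ y) \<in> borel_measurable N"
      unfolding p_def by simp
    have "emeasure M {\<omega>\<in>space M. V \<omega> \<in> B \<and> Y \<omega> = y} = (\<integral>\<^sup>+v. ennreal (indicator B v * p v $ y) \<partial>D)"
      unfolding er[OF B]
    proof (rule nn_integral_cong_AE, use AEG in eventually_elim)
      case (elim v)
      then show ?case using rfin[OF elim, of y]
        by (auto simp: p_def less_top split: split_indicator)
    qed
    then show ?thesis
      unfolding set_lebesgue_integral_def D_def[symmetric] measure_def
      by (subst integral_eq_nn_integral) (auto simp: p_def)
  qed
  ultimately show ?thesis unfolding cond_dist_def by blast
qed

end

theory Submission
  imports Defs
begin

text \<open>
  The representation \<open>Z\<close> is first replaced by \<open>p(Z)\<close>, where \<open>p(z) = P(Y | Z = z)\<close>. This is a function of \<open>Z\<close>,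
  so the total variation distance does not grow, and it is still sufficient for \<open>Y\<close>:
  \<open>P(Y | p(Z)) = p(Z)\<close>. Its values lie in the simplex, which embeds measurably into the reals with a
  measurable left inverse, and for real random variables a regular conditional distribution given
  \<open>(X', A)\<close> exists, whatever the spaces of values of \<open>X\<close> and \<open>Z\<close>. Sampling \<open>Z'\<close> from this kernel
  reproduces the joint law of \<open>p(Z)\<close> with \<open>(X', A)\<close>, and also with \<open>Y\<close>, because \<open>P(Y | X, A) = X'\<close>
  depends on \<open>(X, A)\<close> only through \<open>X'\<close>. The two expectations of \<open>h\<close> are then equal.
\<close>

subsection \<open>Encoding the simplex in the reals\<close>

text \<open>Base 4 with digits 0 and 1 only: the tail after any digit stays below one unit of that
  digit, so no two bit sequences share a code, unlike in binary.\<close>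

definition bit_code :: "(nat \<Rightarrow> bool) \<Rightarrow> real" where
  "bit_code b = (\<Sum>n. of_bool (b n) / 4 ^ Suc n)"

text \<open>Each application of \<open>frac (4 * r)\<close> drops the leading digit, and a code
  reaches 1/4 exactly when its leading digit is 1. On reals that are not codes the result is
  arbitrary but still measurable.\<close>

definition code_bit :: "nat \<Rightarrow> real \<Rightarrow> bool" where
  "code_bit n r \<longleftrightarrow> 1 / 4 \<le> ((\<lambda>r. frac (4 * r)) ^^ n) r"

lemma summable_bit_code: "summable (\<lambda>n. of_bool (b n) / 4 ^ Suc n :: real)"
proof (rule summable_comparison_test')
  show "summable (\<lambda>n. (1 / 4) ^ Suc n :: real)"
    by (subst summable_Suc_iff) (rule summable_geometric, simp)
  show "norm (of_bool (b n) / 4 ^ Suc n :: real) \<le> (1 / 4) ^ Suc n" for n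
    by (simp add: power_divide)
qed

lemma bit_code_nonneg: "0 \<le> bit_code b"
  unfolding bit_code_def by (rule suminf_nonneg[OF summable_bit_code]) simp

text \<open>The geometric series gives 1/3. Strictness below 1 is what the decoding needs: it makes
  the shifted code the fractional part of \<open>4 * bit_code b\<close>.\<close>

lemma bit_code_less_1: "bit_code b < 1"
proof -
  have s: "(\<lambda>n. (1 / 4) ^ n :: real) sums (1 / (1 - 1 / 4))"
    by (rule geometric_sums) simp
  have "(\<lambda>n. (1 / 4) * (1 / 4) ^ n :: real) sums ((1 / 4) * (1 / (1 - 1 / 4)))"
    using s by (rule sums_mult)
  then have s: "(\<lambda>n. (1 / 4) ^ Suc n :: real) sums (1 / 3)"
    by simp
  have "bit_code b \<le> (\<Sum>n. (1 / 4) ^ Suc n)"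
    unfolding bit_code_def
    by (rule suminf_le[OF _ summable_bit_code sums_summable[OF s]]) (simp add: power_divide)
  also have "\<dots> = 1 / 3" using s by (rule sums_unique[symmetric])
  finally show ?thesis by simp
qed

lemma bit_code_rec: "4 * bit_code b = of_bool (b 0) + bit_code (\<lambda>n. b (Suc n))"
proof -
  have "bit_code b = (\<Sum>n. of_bool (b (Suc n)) / 4 ^ Suc (Suc n)) + of_bool (b 0) / 4"
    unfolding bit_code_def using suminf_split_head[OF summable_bit_code[of b]] by simp
  also have "(\<Sum>n. of_bool (b (Suc n)) / 4 ^ Suc (Suc n)) = (\<Sum>n. of_bool (b (Suc n)) / 4 ^ Suc n / (4::real))"
    by (simp add: mult.commute)
  also have "\<dots> = bit_code (\<lambda>n. b (Suc n)) / 4"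
    unfolding bit_code_def by (rule suminf_divide[OF summable_bit_code])
  finally show ?thesis by simp
qed

text \<open>By \<open>bit_code_rec\<close>, four times the code is the first bit plus a number in
  [0,1). So the comparison with 1/4 reads that bit and \<open>frac\<close> leaves the code of the
  shifted sequence, to which the induction hypothesis applies.\<close>

lemma code_bit_bit_code: "code_bit n (bit_code b) = b n"
proof (induction n arbitrary: b)
  case 0
  show ?case
    using bit_code_rec[of b] bit_code_nonneg[of "\<lambda>n. b (Suc n)"] bit_code_less_1[of "\<lambda>n. b (Suc n)"]
    by (cases "b 0") (auto simp: code_bit_def)
next
  case (Suc n)
  have "frac (4 * bit_code b) = bit_code (\<lambda>n. b (Suc n))"
    using bit_code_rec[of b] bit_code_nonneg[of "\<lambda>n. b (Suc n)"] bit_code_less_1[of "\<lambda>n. b (Suc n)"]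
    by (auto simp: frac_unique_iff)
  then have "code_bit (Suc n) (bit_code b) = code_bit n (bit_code (\<lambda>n. b (Suc n)))"
    by (simp add: code_bit_def funpow_Suc_right del: funpow.simps)
  then show ?case using Suc by simp
qed

lemma measurable_code_bit [measurable]: "Measurable.pred borel (code_bit n)"
proof -
  have [measurable]: "(\<lambda>r. frac (4 * r) :: real) \<in> borel_measurable borel"
    unfolding frac_def by measurable
  have [measurable]: "(\<lambda>r::real. frac (4 * r)) ^^ n \<in> borel_measurable borel"
    by (induction n) (auto intro: measurable_comp)
  show ?thesis unfolding code_bit_def by measurable
qed

lemma prob_simplex_bounds:
  assumes "x \<in> prob_simplex" shows "0 \<le> x $ y" "x $ y \<le> 1"
proof -
  show 0: "0 \<le> x $ y" using assms by (simp add: prob_simplex_def)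
  have "x $ y \<le> (\<Sum>y\<in>UNIV. x $ y)"
    using assms by (intro member_le_sum) (auto simp: prob_simplex_def)
  then show "x $ y \<le> 1" using assms by (simp add: prob_simplex_def)
qed

lemma measurable_vec_lambda:
  assumes "\<And>y. (\<lambda>r. g r y) \<in> borel_measurable N"
  shows "(\<lambda>r. (\<chi> y. g r y) :: real ^ 'y::finite) \<in> borel_measurable N"
  using assms by (subst borel_measurable_euclidean_space) (auto simp: Basis_vec_def inner_axis)

lemma borel_measurable_vec_nth [measurable]: "(\<lambda>x :: real ^ 'y::finite. x $ y) \<in> borel_measurable borel"
  by (intro borel_measurable_continuous_onI continuous_intros)

lemma sets_prob_simplex [measurable]: "prob_simplex \<in> sets (borel :: (real ^ 'y::finite) measure)"
  unfolding prob_simplex_def by measurable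

text \<open>The bits of the code of \<open>x\<close> are the truth values of all comparisons \<open>q \<le> x\<^sub>y\<close> with \<open>q\<close>
  rational, and \<open>x\<^sub>y\<close> is the supremum of the \<open>q\<close> below it.\<close>

lemma prob_simplex_borel_code:
  obtains e :: "real ^ 'y::finite \<Rightarrow> real" and d
  where "e \<in> borel_measurable borel" "\<And>x. e x \<in> {0..<1}"
    "d \<in> borel \<rightarrow>\<^sub>M restrict_space borel prob_simplex"
    "\<And>x. x \<in> prob_simplex \<Longrightarrow> d (e x) = x"
proof -
  have c: "countable (UNIV :: (rat \<times> 'y) set)"
    using countable_SIGMA[OF countableI_type[of "UNIV :: rat set"] countable_finite[OF finite[of "UNIV :: 'y set"]]]
    by simp
  define u :: "nat \<Rightarrow> rat \<times> 'y" where "u = from_nat_into UNIV"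
  have u: "range u = UNIV" unfolding u_def by (rule range_from_nat_into) (use c in auto)
  define e :: "real ^ 'y \<Rightarrow> real" where
    "e x = bit_code (\<lambda>n. of_rat (fst (u n)) \<le> x $ snd (u n))" for x
  \<comment> \<open>Rationals outside [0,1] and unset bits contribute 0. This keeps \<open>t\<close>
    bounded for every real \<open>r\<close>, so that the supremum over \<open>n\<close> exists and
    is measurable, and it costs nothing on codes because coordinates in the simplex lie in
    [0,1].\<close>
  define t where "t y r n = (if code_bit n r \<and> snd (u n) = y \<and> 0 \<le> fst (u n) \<and> fst (u n) \<le> 1
      then of_rat (fst (u n)) else 0 :: real)" for y r n
  have t1: "t y r n \<le> 1" for y r n by (simp add: t_def)
  have bdd: "bdd_above (range (t y r))" for y r by (rule bdd_aboveI2[OF t1])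
  define d0 :: "real \<Rightarrow> real ^ 'y" where "d0 r = (\<chi> y. SUP n. t y r n)" for r
  define c0 :: "real ^ 'y" where "c0 = (\<chi> y. 1 / real CARD('y))"
  \<comment> \<open>The uniform distribution \<open>c0\<close> is the default that keeps
    \<open>d\<close> inside the simplex on reals that encode no point of it.\<close>
  define d where "d r = (if d0 r \<in> prob_simplex then d0 r else c0)" for r
  have c0: "c0 \<in> prob_simplex" by (simp add: c0_def prob_simplex_def)
  have em: "e \<in> borel_measurable borel" unfolding e_def bit_code_def by measurable
  have tm[measurable]: "(\<lambda>r. t y r n) \<in> borel_measurable borel" for y n unfolding t_def by measurable
  have d0m[measurable]: "d0 \<in> borel_measurable borel"
    unfolding d0_def by (intro measurable_vec_lambda borel_measurable_cSUP bdd) auto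
  have dm: "d \<in> borel \<rightarrow>\<^sub>M restrict_space borel prob_simplex"
  proof (rule measurable_restrict_space2)
    show "d \<in> space borel \<rightarrow> prob_simplex" using c0 by (auto simp: d_def)
    show "d \<in> borel_measurable borel" unfolding d_def by measurable
  qed
  have de: "d (e x) = x" if x: "x \<in> prob_simplex" for x
  proof -
    have "(SUP n. t y (e x) n) = x $ y" for y
    proof (rule antisym)
      show "(SUP n. t y (e x) n) \<le> x $ y"
        by (rule cSUP_least) (auto simp: t_def e_def code_bit_bit_code prob_simplex_bounds[OF x])
      show "x $ y \<le> (SUP n. t y (e x) n)"
      proof (rule ccontr)
        assume "\<not> x $ y \<le> (SUP n. t y (e x) n)"
        \<comment> \<open>A positive coordinate leaves room for a nonnegative rational above the
          supremum, whose own bit then contradicts it. A zero coordinate leaves no such room, but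
          there the supremum would be negative, although every \<open>t\<close> is at least
          0.\<close>
        then have "max 0 (SUP n. t y (e x) n) < x $ y \<or> x $ y = 0 \<and> (SUP n. t y (e x) n) < 0"
          using prob_simplex_bounds(1)[OF x, of y] by auto
        then show False
        proof
          assume "max 0 (SUP n. t y (e x) n) < x $ y"
          then obtain q where q: "max 0 (SUP n. t y (e x) n) < of_rat q" "of_rat q < x $ y"
            using of_rat_dense by blast
          obtain n where n: "u n = (q, y)" using u by (metis UNIV_I imageE)
          have "(of_rat q :: real) \<le> 1" "0 \<le> (of_rat q :: real)"
            using q prob_simplex_bounds(2)[OF x, of y] by linarith+
          then have "q \<le> 1" "0 \<le> q" by simp_all
          then have "t y (e x) n = of_rat q"
            using q(2) by (simp add: t_def e_def code_bit_bit_code n)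
          moreover have "t y (e x) n \<le> (SUP n. t y (e x) n)" by (intro cSUP_upper bdd) auto
          ultimately show False using q(1) by simp
        next
          assume *: "x $ y = 0 \<and> (SUP n. t y (e x) n) < 0"
          have "0 \<le> t y (e x) 0" by (simp add: t_def)
          also have "\<dots> \<le> (SUP n. t y (e x) n)" by (intro cSUP_upper bdd) auto
          finally show False using * by simp
        qed
      qed
    qed
    then have "d0 (e x) = x" by (simp add: d0_def vec_eq_iff)
    then show ?thesis using x by (simp add: d_def)
  qed
  show ?thesis
    by (rule that[OF em _ dm de]) (auto simp: e_def bit_code_nonneg bit_code_less_1)
qed

subsection \<open>Regular conditional distributions of real random variables\<close>

text \<open>Test the hypothesis on the set where \<open>v s < u s\<close>: the integral of the
  positive difference over it is at most 0, so the set is null.\<close>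

lemma AE_le_of_set_integral_le:
  fixes u v :: "'a \<Rightarrow> real"
  assumes u: "integrable D u" and v: "integrable D v"
    and le: "\<And>B. B \<in> sets D \<Longrightarrow> (LINT s:B|D. u s) \<le> (LINT s:B|D. v s)"
  shows "AE s in D. u s \<le> v s"
proof -
  have [measurable]: "u \<in> borel_measurable D" "v \<in> borel_measurable D" using u v by auto
  define B where "B = {s\<in>space D. v s < u s}"
  have B: "B \<in> sets D" unfolding B_def by measurable
  have iu: "set_integrable D B u" and iv: "set_integrable D B v"
    unfolding set_integrable_def using u v B integrable_mult_indicator by blast+
  have i: "set_integrable D B (\<lambda>s. u s - v s)" using iu iv by (rule set_integral_diff)
  have "(LINT s:B|D. u s - v s) = (LINT s:B|D. u s) - (LINT s:B|D. v s)"
    using iu iv by (rule set_integral_diff)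
  then have "(LINT s:B|D. u s - v s) \<le> 0" using le[OF B] by simp
  moreover have "0 \<le> (LINT s:B|D. u s - v s)"
    unfolding set_lebesgue_integral_def
    by (rule integral_nonneg_AE) (auto simp: B_def split: split_indicator)
  ultimately have "(\<integral>s. indicator B s *\<^sub>R (u s - v s) \<partial>D) = 0"
    unfolding set_lebesgue_integral_def by simp
  then have "AE s in D. indicator B s *\<^sub>R (u s - v s) = 0"
    using i unfolding set_integrable_def
    by (subst (asm) integral_nonneg_eq_0_iff_AE) (auto simp: B_def split: split_indicator)
  then show ?thesis
    using AE_space by eventually_elim (force simp: B_def split: split_indicator_asm)
qed

text \<open>\<open>H\<close> itself may be irregular. The infimum increases because fewer rationals
  compete for larger \<open>x\<close>. It is right-continuous because a rational \<open>q\<close>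
  that nearly attains the infimum at \<open>x\<close> still competes at every point between
  \<open>x\<close> and \<open>q\<close>. The prescribed values of \<open>H\<close> below 0 and from
  1 on give the limits.\<close>

lemma INF_rat_greater_cdf:
  fixes H :: "real \<Rightarrow> real"
  assumes H: "\<And>q. 0 \<le> H q" "\<And>q. q < 0 \<Longrightarrow> H q = 0" "\<And>q. 1 \<le> q \<Longrightarrow> H q = 1"
  defines "F \<equiv> \<lambda>x::real. INF q\<in>{q. x < of_rat q}. H (of_rat q)"
  shows "x \<le> y \<Longrightarrow> F x \<le> F y" and "continuous (at_right x) F"
    and "(F \<longlongrightarrow> 0) at_bot" and "(F \<longlongrightarrow> 1) at_top"
proof -
  have bdd: "bdd_below ((\<lambda>q. H (of_rat q)) ` Q)" for Q
    by (rule bdd_belowI2[where m = 0]) (rule H)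
  have ne: "{q. x < real_of_rat q} \<noteq> {}" for x
    using of_rat_dense[of x "x + 1"] by auto
  have le: "F x \<le> H (of_rat q)" if "x < of_rat q" for x q
    unfolding F_def by (rule cINF_lower[OF bdd]) (use that in simp)
  have ge: "c \<le> F x" if "\<And>q. x < of_rat q \<Longrightarrow> c \<le> H (of_rat q)" for x c
    unfolding F_def by (rule cINF_greatest[OF ne]) (use that in simp)
  show mono: "F x \<le> F y" if "x \<le> y" for x y
    by (rule ge) (use that in \<open>auto intro: le\<close>)
  have "(F \<longlongrightarrow> F x) (at_right x)"
  proof (rule order_tendstoI)
    fix c assume "c < F x"
    then show "\<forall>\<^sub>F y in at_right x. c < F y"
      unfolding eventually_at_right_field by (intro exI[of _ "x + 1"]) (auto intro: less_le_trans[OF _ mono])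
  next
    fix c assume "F x < c"
    then obtain q where q: "x < of_rat q" "H (of_rat q) < c"
      unfolding F_def using cINF_less_iff[OF ne bdd] by auto
    then show "\<forall>\<^sub>F y in at_right x. F y < c"
      unfolding eventually_at_right_field by (intro exI[of _ "of_rat q"]) (auto intro: le_less_trans[OF le])
  qed
  then show "continuous (at_right x) F" by (simp add: continuous_within)
  have "F x = 0" if x: "x < 0" for x
  proof (rule antisym)
    obtain q where "x < of_rat q" "of_rat q < (0::real)" using of_rat_dense[OF x] by metis
    then show "F x \<le> 0" using le[of x q] H(2)[of "of_rat q"] by simp
    show "0 \<le> F x" by (rule ge) (rule H)
  qed
  then show "(F \<longlongrightarrow> 0) at_bot"
    by (intro tendsto_eventually) (auto simp: eventually_at_bot_dense)
  have "F x = 1" if x: "1 \<le> x" for x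
  proof (rule antisym)
    have H1: "H (of_rat q) = 1" if "x < of_rat q" for q
      by (rule H(3)) (use x that in linarith)
    obtain q where "x < of_rat q" using ne[of x] by auto
    then show "F x \<le> 1" using le[of x q] H1[of q] by simp
    show "1 \<le> F x" by (rule ge) (simp add: H1)
  qed
  then show "(F \<longlongrightarrow> 1) at_top"
    by (intro tendsto_eventually) (auto simp: eventually_at_top_linorder)
qed

text \<open>With \<open>B\<close> fixed, a joint law becomes a measure in \<open>C\<close> alone, so
  facts about measures on the range of \<open>W\<close>, such as uniqueness from the distribution
  function, apply to it.\<close>

lemma emeasure_distr_restrict:
  assumes [measurable]: "S \<in> M \<rightarrow>\<^sub>M L" "W \<in> M \<rightarrow>\<^sub>M N" "B \<in> sets L" "C \<in> sets N"
  shows "emeasure (distr (density M (indicator {\<omega>\<in>space M. S \<omega> \<in> B})) N W) C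
    = emeasure M {\<omega>\<in>space M. S \<omega> \<in> B \<and> W \<omega> \<in> C}"
proof -
  have "emeasure (distr (density M (indicator {\<omega>\<in>space M. S \<omega> \<in> B})) N W) C
      = (\<integral>\<^sup>+\<omega>. indicator {\<omega>\<in>space M. S \<omega> \<in> B} \<omega> * indicator (W -` C \<inter> space M) \<omega> \<partial>M)"
    by (subst emeasure_distr) (auto simp: emeasure_density)
  also have "\<dots> = (\<integral>\<^sup>+\<omega>. indicator {\<omega>\<in>space M. S \<omega> \<in> B \<and> W \<omega> \<in> C} \<omega> \<partial>M)"
    by (intro nn_integral_cong) (auto split: split_indicator)
  finally show ?thesis by simp
qed

lemma (in finite_measure) finite_borel_measure_distr_restrict:
  assumes "S \<in> M \<rightarrow>\<^sub>M L" "W \<in> borel_measurable M" "B \<in> sets L"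
  shows "finite_borel_measure (distr (density M (indicator {\<omega>\<in>space M. S \<omega> \<in> B})) borel W)"
  using emeasure_distr_restrict[OF assms, of UNIV]
  by (intro finite_borel_measure.intro finite_measureI finite_borel_measure_axioms.intro) auto

lemma cond_dist_bounds:
  assumes "cond_dist M N V Y p" "v \<in> space N"
  shows "0 \<le> p v $ y" "p v $ y \<le> 1"
proof -
  have v: "p v \<in> prob_simplex"
    using assms by (auto simp: cond_dist_def space_restrict_space dest: measurable_space)
  then show "0 \<le> p v $ y" "p v $ y \<le> 1" by (rule prob_simplex_bounds)+
qed

lemma cond_dist_measurable:
  assumes "cond_dist M N V Y p"
  shows "p \<in> N \<rightarrow>\<^sub>M borel" "(\<lambda>v. p v $ y) \<in> borel_measurable N"
proof -
  show p: "p \<in> N \<rightarrow>\<^sub>M borel"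
    using assms by (auto simp: cond_dist_def measurable_restrict_space2_iff)
  show "(\<lambda>v. p v $ y) \<in> borel_measurable N"
    using p borel_measurable_vec_nth by (rule measurable_compose)
qed

text \<open>The conditional distribution function is only controlled at rational points, where
  its versions are monotone almost surely; taking the infimum over larger rationals
  makes it a distribution function for every value of \<open>S\<close>.\<close>

lemma regular_conditional_distribution:
  fixes S :: "'p \<Rightarrow> 's" and W :: "'p \<Rightarrow> real"
  assumes "prob_space P" and S[measurable]: "S \<in> P \<rightarrow>\<^sub>M L" and W[measurable]: "W \<in> borel_measurable P"
    and W01: "\<And>\<omega>. \<omega> \<in> space P \<Longrightarrow> W \<omega> \<in> {0..<1}"
  obtains k where "k \<in> L \<rightarrow>\<^sub>M prob_algebra borel"
    and "\<And>B C. B \<in> sets L \<Longrightarrow> C \<in> sets borel \<Longrightarrow>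
      emeasure P {\<omega>\<in>space P. S \<omega> \<in> B \<and> W \<omega> \<in> C} = (\<integral>\<^sup>+s. emeasure (k s) C * indicator B s \<partial>distr P L S)"
proof -
  interpret P: prob_space P by fact
  define D where "D = distr P L S"
  interpret D: prob_space D unfolding D_def by (rule P.prob_space_distr) fact
  have sD[simp, measurable_cong]: "sets D = sets L" by (simp add: D_def)
  have spD[simp]: "space D = space L" by (simp add: D_def)
  \<comment> \<open>The event \<open>W \<omega> \<le> q\<close> is treated as a Boolean label; the
    component \<open>True\<close> of its conditional distribution is a version of the conditional
    distribution function at \<open>q\<close>.\<close>
  have "\<exists>p. cond_dist P L S (\<lambda>\<omega>. W \<omega> \<le> q) p" for q
    by (rule cond_dist_exists[OF assms(1) S]) measurable
  then obtain p where p: "\<And>q. cond_dist P L S (\<lambda>\<omega>. W \<omega> \<le> q) (p q)" by metis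
  note [measurable] = cond_dist_measurable(2)[OF p]
  \<comment> \<open>As \<open>W\<close> takes values in [0,1), the values 0 and 1 are correct for
    these \<open>q\<close>. Imposing them at every \<open>s\<close>, not just almost surely, gives
    every \<open>F s\<close> its limits at both ends.\<close>
  define H where "H q s = (if q < 0 then 0 else if 1 \<le> q then 1 else p q s $ True)" for q s
  have H0: "0 \<le> H q s" and H1: "H q s \<le> 1" if "s \<in> space L" for q s
    using cond_dist_bounds[OF p that, where y = True] by (auto simp: H_def)
  have Hm[measurable]: "H q \<in> borel_measurable L" for q unfolding H_def by measurable
  have iH: "integrable D (H q)" for q
    by (rule D.integrable_const_bound[where B = 1]) (auto simp: H0 H1)
  have HP: "measure P {\<omega>\<in>space P. S \<omega> \<in> B \<and> W \<omega> \<le> q} = (LINT s:B|D. H q s)"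
    if B[measurable]: "B \<in> sets L" for B q
  proof -
    have "{\<omega>\<in>space P. S \<omega> \<in> B \<and> W \<omega> \<le> q} = (if q < 0 then {} else {\<omega>\<in>space P. S \<omega> \<in> B})"
      if "q < 0 \<or> 1 \<le> q" using that W01 by force
    then have "q < 0 \<Longrightarrow> {\<omega>\<in>space P. S \<omega> \<in> B \<and> W \<omega> \<le> q} = {}"
      "1 \<le> q \<Longrightarrow> {\<omega>\<in>space P. S \<omega> \<in> B \<and> W \<omega> \<le> q} = {\<omega>\<in>space P. S \<omega> \<in> B}" by auto
    moreover have "measure P {\<omega>\<in>space P. S \<omega> \<in> B} = measure D B"
      by (simp add: D_def measure_distr vimage_def Int_def conj_commute)
    moreover have "measure P {\<omega>\<in>space P. S \<omega> \<in> B \<and> (W \<omega> \<le> q) = True} = (LINT s:B|D. p q s $ True)"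
      using p[of q] B unfolding cond_dist_def D_def by blast
    ultimately show ?thesis
      unfolding H_def set_lebesgue_integral_def by (cases "q < 0"; cases "1 \<le> q") simp_all
  qed
  have mono: "AE s in D. H x s \<le> H y s" if "x \<le> y" for x y
  proof (rule AE_le_of_set_integral_le[OF iH iH])
    fix B assume "B \<in> sets D"
    then have [measurable]: "B \<in> sets L" by simp
    have "measure P {\<omega>\<in>space P. S \<omega> \<in> B \<and> W \<omega> \<le> x} \<le> measure P {\<omega>\<in>space P. S \<omega> \<in> B \<and> W \<omega> \<le> y}"
      using that by (intro P.finite_measure_mono) auto
    then show "(LINT s:B|D. H x s) \<le> (LINT s:B|D. H y s)" by (simp add: HP)
  qed
  define F where "F s x = (INF q\<in>{q. x < of_rat q}. H (of_rat q) s)" for s and x :: real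
  have bdd: "bdd_below ((\<lambda>q. H (of_rat q) s) ` Q)" if "s \<in> space L" for s Q
    by (rule bdd_belowI2[where m = 0]) (rule H0[OF that])
  have ne: "{q. x < real_of_rat q} \<noteq> {}" for x
    using of_rat_dense[of x "x + 1"] by auto
  have Fm[measurable]: "(\<lambda>s. F s x) \<in> borel_measurable L" for x
    unfolding F_def by (rule borel_measurable_cINF) (auto intro: bdd)
  have FH: "F s x \<le> H (of_rat q) s" if "x < of_rat q" "s \<in> space L" for s x q
    unfolding F_def by (rule cINF_lower[OF bdd]) (use that in auto)
  have F0: "0 \<le> F s x" if "s \<in> space L" for s x
    unfolding F_def by (rule cINF_greatest[OF ne]) (rule H0[OF that])
  have F1: "F s x \<le> 1" if "s \<in> space L" for s x
    using ne[of x] FH[OF _ that] H1[OF that] by (auto intro: order_trans)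
  have iF: "integrable D (\<lambda>s. F s x)" for x
    by (rule D.integrable_const_bound[where B = 1]) (auto simp: F0 F1)
  note cdf = INF_rat_greater_cdf[of "\<lambda>q. H q s" for s, folded F_def]
  have Hs: "H q s = 0" if "q < 0" for q s using that by (simp add: H_def)
  have Hs': "H q s = 1" if "1 \<le> q" for q s using that by (simp add: H_def)
  define k where "k s = interval_measure (F s)" for s
  have rk: "real_distribution (k s)" if "s \<in> space L" for s
    unfolding k_def by (rule real_distribution_interval_measure) (auto intro!: cdf H0 Hs Hs' that)
  have kF: "emeasure (k s) {..x} = ennreal (F s x)" if "s \<in> space L" for s x
    unfolding k_def by (rule emeasure_interval_measure_Iic) (auto intro!: cdf H0 Hs Hs' that)
  have km[measurable]: "k \<in> L \<rightarrow>\<^sub>M prob_algebra borel"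
  proof (rule measurable_prob_algebra_generated[where \<Omega> = UNIV and G = "range (\<lambda>a::real. {..a})"])
    show "sets borel = sigma_sets UNIV (range (\<lambda>a::real. {..a}))"
      by (subst borel_eq_atMost) simp
    show "Int_stable (range (\<lambda>a::real. {..a}))"
      by (auto simp: Int_stable_def)
    fix s assume s: "s \<in> space L"
    interpret real_distribution "k s" by (rule rk[OF s])
    show "prob_space (k s)" by (rule prob_space_axioms)
    show "sets (k s) = sets borel" by simp
  next
    fix C assume "C \<in> range (\<lambda>a::real. {..a})"
    then obtain x where C: "C = {..x}" by auto
    show "(\<lambda>s. emeasure (k s) C) \<in> borel_measurable L"
      by (subst measurable_cong[where g = "\<lambda>s. ennreal (F s x)"]) (auto simp: C kF)
  qed auto
  have FP: "(LINT s:B|D. F s x) = measure P {\<omega>\<in>space P. S \<omega> \<in> B \<and> W \<omega> \<le> x}"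
    if B[measurable]: "B \<in> sets L" for B x
  proof (rule antisym)
    have si: "set_integrable D B u" if "integrable D u" for u :: "_ \<Rightarrow> real"
      unfolding set_integrable_def using that by (intro integrable_mult_indicator) auto
    \<comment> \<open>The rationals are countable, so the exceptional null sets of
      \<open>mono\<close> combine into one.\<close>
    have "AE s in D. \<forall>q\<in>{q. x < of_rat q}. H x s \<le> H (of_rat q) s"
      by (subst AE_ball_countable) (auto intro!: mono)
    then have "AE s in D. H x s \<le> F s x"
      unfolding F_def by eventually_elim (rule cINF_greatest[OF ne], simp)
    then have "(LINT s:B|D. H x s) \<le> (LINT s:B|D. F s x)"
      by (intro set_integral_mono_AE si iH iF) auto
    then show "measure P {\<omega>\<in>space P. S \<omega> \<in> B \<and> W \<omega> \<le> x} \<le> (LINT s:B|D. F s x)"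
      by (simp add: HP)
    define m where "m = distr (density P (indicator {\<omega>\<in>space P. S \<omega> \<in> B})) borel W"
    note em = emeasure_distr_restrict[OF S W B, folded m_def]
    interpret m: finite_borel_measure m
      unfolding m_def by (rule P.finite_borel_measure_distr_restrict[OF S W B])
    have cm: "cdf m y = measure P {\<omega>\<in>space P. S \<omega> \<in> B \<and> W \<omega> \<le> y}" for y
      unfolding cdf_def measure_def by (simp add: em)
    \<comment> \<open>\<open>H x\<close> bounds \<open>F s x\<close> from the wrong side here. For
      \<open>y\<close> above \<open>x\<close>, a rational between them bounds the integral by
      \<open>cdf m y\<close>, and right continuity of \<open>cdf m\<close> lets \<open>y\<close>
      decrease to \<open>x\<close>.\<close>
    have "(LINT s:B|D. F s x) \<le> cdf m x"
    proof (rule tendsto_lowerbound)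
      show "(cdf m \<longlongrightarrow> cdf m x) (at_right x)"
        using m.cdf_is_right_cont by (simp add: continuous_within)
      have "(LINT s:B|D. F s x) \<le> cdf m y" if xy: "x < y" for y
      proof -
        obtain q where q: "x < of_rat q" "of_rat q < y" using of_rat_dense[OF xy] by blast
        have "(LINT s:B|D. F s x) \<le> (LINT s:B|D. H (of_rat q) s)"
          using q by (intro set_integral_mono_AE si iH iF) (auto intro!: AE_I2 FH)
        also have "\<dots> = cdf m (of_rat q)" by (simp add: HP cm)
        also have "\<dots> \<le> cdf m y" using q by (intro m.cdf_nondecreasing) simp
        finally show ?thesis .
      qed
      then show "\<forall>\<^sub>F y in at_right x. (LINT s:B|D. F s x) \<le> cdf m y"
        by (auto simp: eventually_at_right_field intro!: exI[of _ "x + 1"])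
    qed simp
    then show "(LINT s:B|D. F s x) \<le> measure P {\<omega>\<in>space P. S \<omega> \<in> B \<and> W \<omega> \<le> x}"
      by (simp add: cm)
  qed
  have main: "emeasure P {\<omega>\<in>space P. S \<omega> \<in> B \<and> W \<omega> \<in> C} = (\<integral>\<^sup>+s. emeasure (k s) C * indicator B s \<partial>D)"
    if B[measurable]: "B \<in> sets L" and C: "C \<in> sets borel" for B C
  proof -
    \<comment> \<open>Both sides of the claim are finite Borel measures in \<open>C\<close>.
      \<open>FP\<close> says that they agree on all half-lines, which determines them.\<close>
    define m1 where "m1 = distr (density P (indicator {\<omega>\<in>space P. S \<omega> \<in> B})) borel W"
    define m2 where "m2 = density D (indicator B) \<bind> k"
    note e1 = emeasure_distr_restrict[OF S W B, folded m1_def]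
    have ks: "k \<in> density D (indicator B) \<rightarrow>\<^sub>M subprob_algebra borel"
      using measurable_prob_algebraD[OF km] by simp
    have nS: "space (density D (indicator B)) \<noteq> {}"
      using D.not_empty by simp
    have e2: "emeasure m2 C = (\<integral>\<^sup>+s. emeasure (k s) C * indicator B s \<partial>D)" if [measurable]: "C \<in> sets borel" for C
    proof -
      have [measurable]: "(\<lambda>s. emeasure (k s) C) \<in> borel_measurable L"
        by (rule measurable_emeasure_kernel[OF measurable_prob_algebraD[OF km]]) fact
      show ?thesis unfolding m2_def
        by (subst emeasure_bind[OF nS ks]) (auto simp: nn_integral_density mult.commute)
    qed
    have s2: "sets m2 = sets borel" unfolding m2_def by (rule sets_bind[OF _ nS]) (use rk in \<open>auto simp: real_distribution.events_eq_borel\<close>)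
    have f1: "finite_borel_measure m1"
      unfolding m1_def by (rule P.finite_borel_measure_distr_restrict[OF S W B])
    have f2: "finite_borel_measure m2"
    proof (intro finite_borel_measure.intro finite_measureI finite_borel_measure_axioms.intro)
      have "emeasure m2 UNIV \<le> (\<integral>\<^sup>+s. 1 \<partial>D)"
        unfolding e2[OF sets.top, simplified]
        by (intro nn_integral_mono) (auto split: split_indicator intro!: prob_space.emeasure_le_1 real_distribution.axioms(1) rk)
      then show "emeasure m2 (space m2) \<noteq> \<infinity>"
        using sets_eq_imp_space_eq[OF s2] D.emeasure_space_1 by (auto simp: top_unique)
    qed (rule s2)
    have "cdf m1 = cdf m2"
    proof
      fix x
      have "emeasure m2 {..x} = (\<integral>\<^sup>+s. ennreal (indicator B s * F s x) \<partial>D)"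
        by (subst e2) (auto intro!: nn_integral_cong simp: kF split: split_indicator)
      also have "\<dots> = ennreal (LINT s:B|D. F s x)"
        unfolding set_lebesgue_integral_def using iF[of x]
        by (subst nn_integral_eq_integral)
          (auto intro!: AE_I2 integrable_mult_indicator[where 'b = real, simplified] simp: F0)
      also have "\<dots> = emeasure m1 {..x}"
        by (simp add: FP e1 P.emeasure_eq_measure)
      finally show "cdf m1 x = cdf m2 x" by (simp add: cdf_def measure_def)
    qed
    then have "m1 = m2" by (rule cdf_unique'[OF f1 f2])
    then show ?thesis using e1[OF C] e2[OF C] by simp
  qed
  show ?thesis by (rule that[OF km main[unfolded D_def]])
qed

subsection \<open>Data processing for the total variation distance\<close>

text \<open>Duality of L1 and bounded functions: with densities \<open>f\<close> and
  \<open>g\<close>, twice the distance is the largest integral of \<open>(f z - g z) * s z\<close>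
  over measurable \<open>s\<close> bounded by 1. Test functions, unlike densities, can be pulled
  back along a map.\<close>

lemma tv_dist_variational:
  assumes "prob_space \<mu>" "prob_space \<nu>" and sets: "sets \<nu> = sets \<mu>"
  shows integral_diff_le_tv_dist: "\<And>s. s \<in> borel_measurable \<mu> \<Longrightarrow> (\<And>z. \<bar>s z\<bar> \<le> 1) \<Longrightarrow>
      (\<integral>z. s z \<partial>\<mu>) - (\<integral>z. s z \<partial>\<nu>) \<le> 2 * tv_dist \<mu> \<nu>"
    and tv_dist_attained: "\<exists>s\<in>borel_measurable \<mu>. (\<forall>z. \<bar>s z\<bar> \<le> 1) \<and>
      (\<integral>z. s z \<partial>\<mu>) - (\<integral>z. s z \<partial>\<nu>) = 2 * tv_dist \<mu> \<nu>"
proof -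
  interpret m: prob_space \<mu> by fact
  interpret n: prob_space \<nu> by fact
  define S where "S = sum_meas \<mu> \<nu>"
  have sS[simp, measurable_cong]: "sets S = sets \<mu>" by (simp add: S_def)
  have spS: "space S = space \<mu>" by (simp add: S_def)
  have [simp, measurable_cong]: "sets \<nu> = sets \<mu>" by (rule sets)
  have e: "emeasure S B = emeasure \<mu> B + emeasure \<nu> B" if "B \<in> sets \<mu>" for B
    unfolding S_def by (rule emeasure_sum_meas) (use that sets in auto)
  have "finite_measure S"
  proof (rule finite_measureI)
    show "emeasure S (space S) \<noteq> \<infinity>" using e[of "space \<mu>"] by (auto simp: spS)
  qed
  then interpret S: finite_measure S .
  \<comment> \<open>\<open>tv_dist\<close> reads derivatives through \<open>enn2real\<close>, which
    sends infinity to 0. Domination by \<open>S\<close> gives absolute continuity, and the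
    derivative is then finite almost everywhere, so the real-valued version is still a
    density.\<close>
  have dens: "density S (\<lambda>z. ennreal (enn2real (RN_deriv S W z))) = W"
      "integrable S (\<lambda>z. enn2real (RN_deriv S W z))"
    if "prob_space W" and sW: "sets W = sets S" and le: "\<And>B. B \<in> sets S \<Longrightarrow> emeasure W B \<le> emeasure S B" for W
  proof -
    interpret W: prob_space W by fact
    have ac: "absolutely_continuous S W"
      unfolding absolutely_continuous_def
    proof
      fix B assume "B \<in> null_sets S"
      then have "B \<in> sets S" "emeasure S B = 0" by auto
      then show "B \<in> null_sets W" using le[of B] sW by auto
    qed
    have fin: "AE z in S. RN_deriv S W z \<noteq> \<infinity>"
      by (rule S.RN_deriv_finite[OF _ ac sW]) unfold_locales
    have "density S (\<lambda>z. ennreal (enn2real (RN_deriv S W z))) = density S (RN_deriv S W)"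
    proof (rule density_cong)
      show "AE z in S. ennreal (enn2real (RN_deriv S W z)) = RN_deriv S W z"
        using fin by eventually_elim (auto simp: less_top)
    qed measurable
    also have "\<dots> = W" by (rule S.density_RN_deriv[OF ac sW])
    finally show d: "density S (\<lambda>z. ennreal (enn2real (RN_deriv S W z))) = W" .
    have "(\<integral>\<^sup>+z. ennreal (enn2real (RN_deriv S W z)) \<partial>S)
        = (\<integral>\<^sup>+z. ennreal (enn2real (RN_deriv S W z)) * indicator (space S) z \<partial>S)"
      by (intro nn_integral_cong) simp
    also have "\<dots> = emeasure (density S (\<lambda>z. ennreal (enn2real (RN_deriv S W z)))) (space S)"
      by (rule emeasure_density[symmetric]) (simp_all add: spS)
    also have "\<dots> = 1"
      unfolding d using W.emeasure_space_1 sets_eq_imp_space_eq[OF sW] by simp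
    finally have "(\<integral>\<^sup>+z. ennreal (enn2real (RN_deriv S W z)) \<partial>S) = 1" .
    then show "integrable S (\<lambda>z. enn2real (RN_deriv S W z))"
      by (intro integrableI_nonneg) auto
  qed
  define f where "f z = enn2real (RN_deriv S \<mu> z)" for z
  define g where "g z = enn2real (RN_deriv S \<nu> z)" for z
  have f: "density S (\<lambda>z. ennreal (f z)) = \<mu>" "integrable S f"
    unfolding f_def by (rule dens; use e assms in simp)+
  have g: "density S (\<lambda>z. ennreal (g z)) = \<nu>" "integrable S g"
    unfolding g_def by (rule dens; use e assms in simp)+
  have [measurable]: "f \<in> borel_measurable \<mu>" "g \<in> borel_measurable \<mu>"
    unfolding f_def g_def using borel_measurable_RN_deriv[of S] by measurable
  have tv: "2 * tv_dist \<mu> \<nu> = (\<integral>z. \<bar>f z - g z\<bar> \<partial>S)"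
    by (simp add: tv_dist_def Let_def S_def f_def g_def)
  have diff: "(\<integral>z. s z \<partial>\<mu>) - (\<integral>z. s z \<partial>\<nu>) = (\<integral>z. (f z - g z) * s z \<partial>S)"
    and int: "integrable S (\<lambda>z. (f z - g z) * s z)"
    if s[measurable]: "s \<in> borel_measurable \<mu>" and b: "\<And>z. \<bar>s z\<bar> \<le> 1" for s :: "_ \<Rightarrow> real"
  proof -
    have i: "integrable S (\<lambda>z. u z * s z)" if "integrable S u" "u \<in> borel_measurable \<mu>" for u :: "_ \<Rightarrow> real"
    proof (rule Bochner_Integration.integrable_bound[OF that(1)])
      show "(\<lambda>z. u z * s z) \<in> borel_measurable S" using that(2) by measurable
      show "AE z in S. norm (u z * s z) \<le> norm (u z)"
        using b by (auto simp: abs_mult intro!: mult_left_le)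
    qed
    have "(\<integral>z. s z \<partial>\<mu>) = (\<integral>z. f z * s z \<partial>S)"
      unfolding f(1)[symmetric] by (subst integral_density) (auto simp: f_def)
    moreover have "(\<integral>z. s z \<partial>\<nu>) = (\<integral>z. g z * s z \<partial>S)"
      unfolding g(1)[symmetric] by (subst integral_density) (auto simp: g_def)
    ultimately show "(\<integral>z. s z \<partial>\<mu>) - (\<integral>z. s z \<partial>\<nu>) = (\<integral>z. (f z - g z) * s z \<partial>S)"
      using i[OF f(2)] i[OF g(2)] by (simp add: left_diff_distrib)
    show "integrable S (\<lambda>z. (f z - g z) * s z)"
      using f(2) g(2) by (intro i) auto
  qed
  show "(\<integral>z. s z \<partial>\<mu>) - (\<integral>z. s z \<partial>\<nu>) \<le> 2 * tv_dist \<mu> \<nu>"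
    if "s \<in> borel_measurable \<mu>" "\<And>z. \<bar>s z\<bar> \<le> 1" for s
    unfolding tv diff[OF that]
  proof (rule integral_mono[OF int[OF that]])
    show "integrable S (\<lambda>z. \<bar>f z - g z\<bar>)" using f(2) g(2) by auto
    fix z
    have "(f z - g z) * s z \<le> \<bar>f z - g z\<bar> * \<bar>s z\<bar>" by (metis abs_ge_self abs_mult)
    also have "\<dots> \<le> \<bar>f z - g z\<bar>" using that(2) by (intro mult_left_le) auto
    finally show "(f z - g z) * s z \<le> \<bar>f z - g z\<bar>" .
  qed
  show "\<exists>s\<in>borel_measurable \<mu>. (\<forall>z. \<bar>s z\<bar> \<le> 1) \<and>
      (\<integral>z. s z \<partial>\<mu>) - (\<integral>z. s z \<partial>\<nu>) = 2 * tv_dist \<mu> \<nu>"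
  \<comment> \<open>The sign of \<open>f z - g z\<close> attains the maximum.\<close>
  proof (intro bexI[of _ "\<lambda>z. if g z \<le> f z then 1 else - 1"] conjI)
    show sm: "(\<lambda>z. if g z \<le> f z then 1 else - 1) \<in> borel_measurable \<mu>" by measurable
    show "(\<integral>z. (if g z \<le> f z then 1 else - 1) \<partial>\<mu>) - (\<integral>z. (if g z \<le> f z then 1 else - 1) \<partial>\<nu>) = 2 * tv_dist \<mu> \<nu>"
      unfolding tv by (subst diff[OF sm]) (auto intro!: Bochner_Integration.integral_cong)
  qed simp
qed

text \<open>An optimal test function for the two images, composed with \<open>T\<close>, is an
  admissible test function for \<open>\<mu>\<close> and \<open>\<nu>\<close>.\<close>

lemma tv_dist_distr_le:
  assumes "prob_space \<mu>" "prob_space \<nu>" and sets: "sets \<nu> = sets \<mu>" and T: "T \<in> \<mu> \<rightarrow>\<^sub>M N"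
  shows "tv_dist (distr \<mu> N T) (distr \<nu> N T) \<le> tv_dist \<mu> \<nu>"
proof -
  have T': "T \<in> \<nu> \<rightarrow>\<^sub>M N" using T measurable_cong_sets[OF sets refl] by blast
  have p: "prob_space (distr \<mu> N T)" "prob_space (distr \<nu> N T)"
    using assms T' by (auto intro: prob_space.prob_space_distr)
  obtain s where s: "s \<in> borel_measurable N" "\<And>z. \<bar>s z\<bar> \<le> 1"
    and eq: "(\<integral>z. s z \<partial>distr \<mu> N T) - (\<integral>z. s z \<partial>distr \<nu> N T) = 2 * tv_dist (distr \<mu> N T) (distr \<nu> N T)"
    using tv_dist_attained[OF p] by auto
  have "(\<integral>z. s (T z) \<partial>\<mu>) - (\<integral>z. s (T z) \<partial>\<nu>) \<le> 2 * tv_dist \<mu> \<nu>"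
    by (rule integral_diff_le_tv_dist[OF assms(1-3)]) (use s T in auto)
  then show ?thesis using eq s(1) by (simp add: integral_distr[OF T] integral_distr[OF T'])
qed

text \<open>The denominator is written as the numerator with \<open>B\<close> replaced by
  \<open>space N\<close>, so that one equation between joint probabilities settles both in
  \<open>cond_law_cong\<close>.\<close>

lemma emeasure_cond_law:
  assumes Z: "Z \<in> M \<rightarrow>\<^sub>M N" and "{\<omega>\<in>space M. A \<omega> = a} \<in> sets M" and "B \<in> sets N"
  shows "emeasure (cond_law M N Z A a) B =
    emeasure M {\<omega>\<in>space M. A \<omega> = a \<and> Z \<omega> \<in> B} / emeasure M {\<omega>\<in>space M. A \<omega> = a \<and> Z \<omega> \<in> space N}"
proof -
  have "emeasure (cond_law M N Z A a) B = emeasure (uniform_measure M {\<omega>\<in>space M. A \<omega> = a}) (Z -` B \<inter> space M)"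
    unfolding cond_law_def using assms by (subst emeasure_distr) auto
  also have "\<dots> = emeasure M ({\<omega>\<in>space M. A \<omega> = a} \<inter> (Z -` B \<inter> space M)) / emeasure M {\<omega>\<in>space M. A \<omega> = a}"
    using assms by (intro emeasure_uniform_measure) auto
  also have "{\<omega>\<in>space M. A \<omega> = a} \<inter> (Z -` B \<inter> space M) = {\<omega>\<in>space M. A \<omega> = a \<and> Z \<omega> \<in> B}" by auto
  also have "{\<omega>\<in>space M. A \<omega> = a} = {\<omega>\<in>space M. A \<omega> = a \<and> Z \<omega> \<in> space N}"
    using measurable_space[OF Z] by auto
  finally show ?thesis .
qed

lemma cond_law_cong:
  assumes "Z \<in> M \<rightarrow>\<^sub>M N" "Z' \<in> M' \<rightarrow>\<^sub>M N"
    and "{\<omega>\<in>space M. A \<omega> = a} \<in> sets M" "{\<omega>\<in>space M'. A' \<omega> = a} \<in> sets M'"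
    and eq: "\<And>B. B \<in> sets N \<Longrightarrow> emeasure M {\<omega>\<in>space M. A \<omega> = a \<and> Z \<omega> \<in> B}
        = emeasure M' {\<omega>\<in>space M'. A' \<omega> = a \<and> Z' \<omega> \<in> B}"
  shows "cond_law M N Z A a = cond_law M' N Z' A' a"
proof (rule measure_eqI)
  fix B assume "B \<in> sets (cond_law M N Z A a)"
  then have B: "B \<in> sets N" by (simp add: cond_law_def)
  show "emeasure (cond_law M N Z A a) B = emeasure (cond_law M' N Z' A' a) B"
    unfolding emeasure_cond_law[OF assms(1,3) B] emeasure_cond_law[OF assms(2,4) B] eq[OF B] eq[OF sets.top] ..
qed (simp add: cond_law_def)

lemma cond_law_compose:
  assumes "Z \<in> M \<rightarrow>\<^sub>M N" "T \<in> N \<rightarrow>\<^sub>M L"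
  shows "cond_law M L (\<lambda>\<omega>. T (Z \<omega>)) A a = distr (cond_law M N Z A a) L T"
  unfolding cond_law_def using assms by (subst distr_distr) (auto simp: comp_def)

lemma prob_space_cond_law:
  assumes "Z \<in> M \<rightarrow>\<^sub>M N" "prob_space M" "0 < measure M {\<omega>\<in>space M. A \<omega> = a}"
  shows "prob_space (cond_law M N Z A a)"
proof -
  interpret prob_space M by fact
  have "prob_space (uniform_measure M {\<omega>\<in>space M. A \<omega> = a})"
    using assms(3) by (intro prob_space_uniform_measure) (auto simp: emeasure_eq_measure)
  then show ?thesis
    unfolding cond_law_def using assms(1) by (intro prob_space.prob_space_distr) auto
qed

lemma D_TV_compose_le:
  assumes Z: "Z \<in> M \<rightarrow>\<^sub>M N" and "prob_space M" and T: "T \<in> N \<rightarrow>\<^sub>M L"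
    and "\<And>a. a \<in> {0, 1} \<Longrightarrow> 0 < measure M {\<omega>\<in>space M. A \<omega> = a}"
  shows "D_TV M L (\<lambda>\<omega>. T (Z \<omega>)) A \<le> D_TV M N Z A"
  unfolding D_TV_def cond_law_compose[OF Z T]
  by (intro tv_dist_distr_le prob_space_cond_law assms) (use T in \<open>auto simp: cond_law_def\<close>)

subsection \<open>Conditional distributions and representations\<close>

text \<open>The hypothesis says that the measures with densities \<open>u\<close> and
  \<open>w\<close> have the same image under \<open>V\<close>, and integrals of functions of
  \<open>V\<close> see only this image.\<close>

lemma nn_integral_conditional:
  assumes V[measurable]: "V \<in> M \<rightarrow>\<^sub>M N" and u[measurable]: "u \<in> borel_measurable M" and w[measurable]: "w \<in> borel_measurable M"
    and eq: "\<And>B. B \<in> sets N \<Longrightarrow> (\<integral>\<^sup>+\<omega>. indicator B (V \<omega>) * u \<omega> \<partial>M) = (\<integral>\<^sup>+\<omega>. indicator B (V \<omega>) * w \<omega> \<partial>M)"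
    and g[measurable]: "g \<in> borel_measurable N"
  shows "(\<integral>\<^sup>+\<omega>. g (V \<omega>) * u \<omega> \<partial>M) = (\<integral>\<^sup>+\<omega>. g (V \<omega>) * w \<omega> \<partial>M)"
proof -
  have *: "(\<integral>\<^sup>+v. g v \<partial>distr (density M u) N V) = (\<integral>\<^sup>+\<omega>. g (V \<omega>) * u \<omega> \<partial>M)"
    if [measurable]: "u \<in> borel_measurable M" "g \<in> borel_measurable N" for g u
    by (subst nn_integral_distr) (auto simp: nn_integral_density mult.commute)
  have "distr (density M u) N V = distr (density M w) N V"
  proof (rule measure_eqI)
    fix B assume "B \<in> sets (distr (density M u) N V)"
    then have [measurable]: "B \<in> sets N" by simp
    show "emeasure (distr (density M u) N V) B = emeasure (distr (density M w) N V) B"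
      using eq[of B] *[OF u, of "indicator B"] *[OF w, of "indicator B"] by simp
  qed simp
  then show ?thesis using *[OF u g] *[OF w g] by simp
qed

text \<open>Extends the defining equation of \<open>cond_dist\<close> from sets to nonnegative
  weights that depend on \<open>V\<close>. The work is the passage from Bochner to nonnegative
  integrals, where the bounds on \<open>p\<close> enter.\<close>

lemma cond_dist_nn_integral:
  assumes "prob_space M" and V[measurable]: "V \<in> M \<rightarrow>\<^sub>M N" and Y[measurable]: "Y \<in> M \<rightarrow>\<^sub>M count_space UNIV"
    and p: "cond_dist M N V Y p" and g: "g \<in> borel_measurable N"
  shows "(\<integral>\<^sup>+\<omega>. g (V \<omega>) * indicator {\<omega>\<in>space M. Y \<omega> = y} \<omega> \<partial>M) = (\<integral>\<^sup>+\<omega>. g (V \<omega>) * ennreal (p (V \<omega>) $ y) \<partial>M)"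
proof (rule nn_integral_conditional[OF V _ _ _ g])
  interpret prob_space M by fact
  note [measurable] = cond_dist_measurable(2)[OF p]
  show "(\<lambda>\<omega>. ennreal (p (V \<omega>) $ y)) \<in> borel_measurable M" by measurable
  fix B assume B[measurable]: "B \<in> sets N"
  have "(\<integral>\<^sup>+\<omega>. indicator B (V \<omega>) * indicator {\<omega>\<in>space M. Y \<omega> = y} \<omega> \<partial>M)
      = (\<integral>\<^sup>+\<omega>. indicator {\<omega>\<in>space M. V \<omega> \<in> B \<and> Y \<omega> = y} \<omega> \<partial>M)"
    by (intro nn_integral_cong) (auto split: split_indicator)
  also have "\<dots> = ennreal (measure M {\<omega>\<in>space M. V \<omega> \<in> B \<and> Y \<omega> = y})"
    by (simp add: emeasure_eq_measure)
  also have "\<dots> = ennreal (LINT v:B|distr M N V. p v $ y)"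
    using p B unfolding cond_dist_def by simp
  also have "\<dots> = ennreal (\<integral>\<omega>. indicator B (V \<omega>) * p (V \<omega>) $ y \<partial>M)"
    unfolding set_lebesgue_integral_def by (subst integral_distr) auto
  also have "\<dots> = (\<integral>\<^sup>+\<omega>. ennreal (indicator B (V \<omega>) * p (V \<omega>) $ y) \<partial>M)"
  proof (rule nn_integral_eq_integral[symmetric])
    show "integrable M (\<lambda>\<omega>. indicator B (V \<omega>) * p (V \<omega>) $ y)"
      using cond_dist_bounds[OF p measurable_space[OF V]]
      by (intro integrable_const_bound[where B = 1]) (auto intro!: AE_I2 split: split_indicator)
    show "AE \<omega> in M. 0 \<le> indicator B (V \<omega>) * p (V \<omega>) $ y"
      using cond_dist_bounds(1)[OF p measurable_space[OF V]] by (auto intro!: AE_I2)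
  qed
  also have "\<dots> = (\<integral>\<^sup>+\<omega>. indicator B (V \<omega>) * ennreal (p (V \<omega>) $ y) \<partial>M)"
    by (intro nn_integral_cong) (auto split: split_indicator)
  finally show "(\<integral>\<^sup>+\<omega>. indicator B (V \<omega>) * indicator {\<omega>\<in>space M. Y \<omega> = y} \<omega> \<partial>M)
      = (\<integral>\<^sup>+\<omega>. indicator B (V \<omega>) * ennreal (p (V \<omega>) $ y) \<partial>M)" .
qed measurable

text \<open>The final claim ranges over all versions of the posteriors, while the proof computes
  with particular ones. Equal set integrals give both inequalities in each of the finitely many
  coordinates.\<close>

lemma cond_dist_AE_unique:
  assumes "prob_space M" and V: "V \<in> M \<rightarrow>\<^sub>M N" and p: "cond_dist M N V Y p" and q: "cond_dist M N V Y q"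
  shows "AE v in distr M N V. p v = q v"
proof -
  interpret D: prob_space "distr M N V" using assms by (simp add: prob_space.prob_space_distr)
  have i: "integrable (distr M N V) (\<lambda>v. p v $ y)" if "cond_dist M N V Y p" for p y
    using cond_dist_bounds[OF that] cond_dist_measurable(2)[OF that]
    by (intro D.integrable_const_bound[where B = 1]) (auto intro!: AE_I2)
  have le: "AE v in distr M N V. p v $ y \<le> q v $ y"
    if "cond_dist M N V Y p" "cond_dist M N V Y q" for p q y
    by (rule AE_le_of_set_integral_le[OF i[OF that(1)] i[OF that(2)]])
      (use that in \<open>simp add: cond_dist_def\<close>)
  have "AE v in distr M N V. p v $ y = q v $ y" for y
    using le[OF p q] le[OF q p] by eventually_elim (rule antisym)
  then have "AE v in distr M N V. \<forall>y\<in>UNIV. p v $ y = q v $ y"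
    by (subst AE_ball_countable) (auto intro: countable_finite)
  then show ?thesis by eventually_elim (simp add: vec_eq_iff)
qed

text \<open>The marginal on \<open>M\<close> is unchanged because the kernel consists of probability
  measures. \<open>emeasure_extend\<close> covers rectangles, and
  \<open>nn_integral_conditional\<close> with \<open>fst\<close> as conditioning variable extends it
  to general weights \<open>g\<close>.\<close>

lemma
  assumes "prob_space M" and V[measurable]: "V \<in> M \<rightarrow>\<^sub>M MV" and K: "representation MV N K"
  shows measurable_fst_extend: "fst \<in> extend M V N K \<rightarrow>\<^sub>M M"
    and measurable_snd_extend: "snd \<in> extend M V N K \<rightarrow>\<^sub>M N"
    and nn_integral_fst_extend: "\<And>g. g \<in> borel_measurable M \<Longrightarrow>
      (\<integral>\<^sup>+x. g (fst x) \<partial>extend M V N K) = (\<integral>\<^sup>+\<omega>. g \<omega> \<partial>M)"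
    and nn_integral_extend: "\<And>g C. g \<in> borel_measurable M \<Longrightarrow> C \<in> sets N \<Longrightarrow>
      (\<integral>\<^sup>+x. g (fst x) * indicator C (snd x) \<partial>extend M V N K) = (\<integral>\<^sup>+\<omega>. g \<omega> * emeasure (K (V \<omega>)) C \<partial>M)"
proof -
  note ext = assms
  have sE[measurable_cong]: "sets (extend M V N K) = sets (M \<Otimes>\<^sub>M N)" by (rule sets_extend[OF ext])
  have spE: "space (extend M V N K) = space M \<times> space N"
    using sets_eq_imp_space_eq[OF sE] by (simp add: space_pair_measure)
  show f[measurable]: "fst \<in> extend M V N K \<rightarrow>\<^sub>M M" and s[measurable]: "snd \<in> extend M V N K \<rightarrow>\<^sub>M N"
    by measurable
  have K'[measurable]: "K \<in> MV \<rightarrow>\<^sub>M prob_algebra N" using K by (simp add: representation_def)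
  have KV: "K (V \<omega>) \<in> space (prob_algebra N)" if "\<omega> \<in> space M" for \<omega>
    using that measurable_space[OF K'] measurable_space[OF V] by blast
  have K1: "emeasure (K (V \<omega>)) (space N) = 1" if "\<omega> \<in> space M" for \<omega>
    using KV[OF that] prob_space.emeasure_space_1[of "K (V \<omega>)"]
    by (auto simp: space_prob_algebra dest: sets_eq_imp_space_eq)
  have d: "distr (extend M V N K) M fst = M"
  proof (rule measure_eqI)
    fix B assume "B \<in> sets (distr (extend M V N K) M fst)"
    then have B[measurable]: "B \<in> sets M" by simp
    have "fst -` B \<inter> space (extend M V N K) = B \<times> space N"
      using sets.sets_into_space[OF B] by (auto simp: spE)
    then have "emeasure (distr (extend M V N K) M fst) B = emeasure (extend M V N K) (B \<times> space N)"
      by (simp add: emeasure_distr)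
    also have "\<dots> = (\<integral>\<^sup>+\<omega>. emeasure (K (V \<omega>)) (space N) * indicator B \<omega> \<partial>M)"
      by (rule emeasure_extend[OF ext]) auto
    also have "\<dots> = (\<integral>\<^sup>+\<omega>. indicator B \<omega> \<partial>M)"
      by (intro nn_integral_cong) (simp add: K1)
    finally show "emeasure (distr (extend M V N K) M fst) B = emeasure M B" by simp
  qed simp
  show fst: "(\<integral>\<^sup>+x. g (fst x) \<partial>extend M V N K) = (\<integral>\<^sup>+\<omega>. g \<omega> \<partial>M)" if "g \<in> borel_measurable M" for g
    using nn_integral_distr[OF f, of g] that by (simp add: d)
  fix g :: "'a \<Rightarrow> ennreal" and C assume [measurable]: "g \<in> borel_measurable M" "C \<in> sets N"
  have [measurable]: "(\<lambda>v. emeasure (K v) C) \<in> borel_measurable MV"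
    by (rule measurable_emeasure_kernel[OF measurable_prob_algebraD[OF K']]) fact
  have "(\<integral>\<^sup>+x. g (fst x) * indicator C (snd x) \<partial>extend M V N K)
      = (\<integral>\<^sup>+x. g (fst x) * emeasure (K (V (fst x))) C \<partial>extend M V N K)"
  proof (rule nn_integral_conditional[OF f])
    fix B assume B[measurable]: "B \<in> sets M"
    have "(\<integral>\<^sup>+x. indicator B (fst x) * indicator C (snd x) \<partial>extend M V N K)
        = (\<integral>\<^sup>+x. indicator (B \<times> C) x \<partial>extend M V N K)"
      by (intro nn_integral_cong) (auto split: split_indicator)
    also have "\<dots> = emeasure (extend M V N K) (B \<times> C)" by (rule nn_integral_indicator) measurable
    also have "\<dots> = (\<integral>\<^sup>+\<omega>. emeasure (K (V \<omega>)) C * indicator B \<omega> \<partial>M)"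
      by (rule emeasure_extend[OF ext]) fact+
    also have "\<dots> = (\<integral>\<^sup>+x. emeasure (K (V (fst x))) C * indicator B (fst x) \<partial>extend M V N K)"
      by (rule fst[symmetric]) measurable
    finally show "(\<integral>\<^sup>+x. indicator B (fst x) * indicator C (snd x) \<partial>extend M V N K)
        = (\<integral>\<^sup>+x. indicator B (fst x) * emeasure (K (V (fst x))) C \<partial>extend M V N K)"
      by (simp add: mult.commute)
  qed measurable
  also have "\<dots> = (\<integral>\<^sup>+\<omega>. g \<omega> * emeasure (K (V \<omega>)) C \<partial>M)"
    by (rule fst) measurable
  finally show "(\<integral>\<^sup>+x. g (fst x) * indicator C (snd x) \<partial>extend M V N K) = (\<integral>\<^sup>+\<omega>. g \<omega> * emeasure (K (V \<omega>)) C \<partial>M)" .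
qed

text \<open>Given \<open>V\<close>, the label is independent of the representation, so it may be replaced by its
  conditional distribution given any finer \<open>V\<^sub>1\<close>.\<close>

lemma emeasure_label_extend:
  assumes "prob_space M" and V1[measurable]: "V\<^sub>1 \<in> M \<rightarrow>\<^sub>M N\<^sub>1" and \<phi>[measurable]: "\<phi> \<in> N\<^sub>1 \<rightarrow>\<^sub>M MV"
    and V: "V = (\<lambda>\<omega>. \<phi> (V\<^sub>1 \<omega>))" and K: "representation MV N K"
    and Y[measurable]: "Y \<in> M \<rightarrow>\<^sub>M count_space UNIV" and p: "cond_dist M N\<^sub>1 V\<^sub>1 Y p" and C[measurable]: "C \<in> sets N"
  shows "emeasure (extend M V N K) {x\<in>space (extend M V N K). Y (fst x) = y \<and> snd x \<in> C}
    = (\<integral>\<^sup>+x. ennreal (p (V\<^sub>1 (fst x)) $ y) * indicator C (snd x) \<partial>extend M V N K)"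
proof -
  have Vm: "V \<in> M \<rightarrow>\<^sub>M MV" unfolding V by measurable
  note ext = assms(1) Vm K
  note [measurable] = measurable_fst_extend[OF ext] measurable_snd_extend[OF ext] cond_dist_measurable(2)[OF p]
  have K'[measurable]: "K \<in> MV \<rightarrow>\<^sub>M prob_algebra N" using K by (simp add: representation_def)
  have [measurable]: "(\<lambda>v. emeasure (K v) C) \<in> borel_measurable MV"
    by (rule measurable_emeasure_kernel[OF measurable_prob_algebraD[OF K']]) fact
  have "emeasure (extend M V N K) {x\<in>space (extend M V N K). Y (fst x) = y \<and> snd x \<in> C}
      = (\<integral>\<^sup>+x. indicator {x\<in>space (extend M V N K). Y (fst x) = y \<and> snd x \<in> C} x \<partial>extend M V N K)"
    by simp
  also have "\<dots> = (\<integral>\<^sup>+x. indicator {\<omega>\<in>space M. Y \<omega> = y} (fst x) * indicator C (snd x) \<partial>extend M V N K)"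
    using measurable_space[OF measurable_fst_extend[OF ext]]
    by (intro nn_integral_cong) (auto split: split_indicator)
  also have "\<dots> = (\<integral>\<^sup>+\<omega>. indicator {\<omega>\<in>space M. Y \<omega> = y} \<omega> * emeasure (K (V \<omega>)) C \<partial>M)"
    by (rule nn_integral_extend[OF ext]) measurable
  \<comment> \<open>The kernel weight is now visibly a function of \<open>V\<^sub>1\<close>, so the
    indicator of the label may be exchanged for \<open>p\<close>.\<close>
  also have "\<dots> = (\<integral>\<^sup>+\<omega>. emeasure (K (\<phi> (V\<^sub>1 \<omega>))) C * indicator {\<omega>\<in>space M. Y \<omega> = y} \<omega> \<partial>M)"
    by (simp add: V mult.commute)
  also have "\<dots> = (\<integral>\<^sup>+\<omega>. emeasure (K (\<phi> (V\<^sub>1 \<omega>))) C * ennreal (p (V\<^sub>1 \<omega>) $ y) \<partial>M)"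
    by (rule cond_dist_nn_integral[OF assms(1) V1 Y p]) measurable
  also have "\<dots> = (\<integral>\<^sup>+\<omega>. ennreal (p (V\<^sub>1 \<omega>) $ y) * emeasure (K (V \<omega>)) C \<partial>M)"
    by (simp add: V mult.commute)
  also have "\<dots> = (\<integral>\<^sup>+x. ennreal (p (V\<^sub>1 (fst x)) $ y) * indicator C (snd x) \<partial>extend M V N K)"
    by (rule nn_integral_extend[OF ext, symmetric]) measurable
  finally show ?thesis .
qed

section \<open>Construction of \<open>Z'\<close> and comparison with \<open>Z\<close>\<close>

theorem lemma3p2:
  fixes M :: "'m measure" and MX :: "'x measure" and N :: "'z measure"
    and X :: "'m \<Rightarrow> 'x" and A :: "'m \<Rightarrow> nat" and Y :: "'m \<Rightarrow> 'y::finite"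
    and h :: "real ^ 'y \<Rightarrow> real" and f :: "'x \<times> nat \<Rightarrow> real ^ 'y"
    and K :: "'x \<times> nat \<Rightarrow> 'z measure"
  defines "XA \<equiv> \<lambda>\<omega>. (X \<omega>, A \<omega>)"
    and "X'A \<equiv> \<lambda>\<omega>. (f (X \<omega>, A \<omega>), A \<omega>)"
  assumes "prob_space M"
    and "X \<in> M \<rightarrow>\<^sub>M MX" and "A \<in> M \<rightarrow>\<^sub>M count_space {0, 1}" and "Y \<in> M \<rightarrow>\<^sub>M count_space UNIV"
    and "\<And>a. a \<in> {0, 1} \<Longrightarrow> 0 < measure M {\<omega>\<in>space M. A \<omega> = a}"
    and "continuous_on prob_simplex h" and "concave_on prob_simplex h"
    and "cond_dist M (MX \<Otimes>\<^sub>M count_space {0, 1}) XA Y f"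
    and "representation (MX \<Otimes>\<^sub>M count_space {0, 1}) N K"
  shows "\<exists>(N' :: real measure) K'.
    representation (restrict_space borel prob_simplex \<Otimes>\<^sub>M count_space {0, 1}) N' K' \<and>
    (\<forall>p p'. cond_dist (extend M XA N K) N snd (Y \<circ> fst) p \<longrightarrow>
            cond_dist (extend M X'A N' K') N' snd (Y \<circ> fst) p' \<longrightarrow>
            (\<integral>z'. h (p' z') \<partial>distr (extend M X'A N' K') N' snd)
              \<le> (\<integral>z. h (p z) \<partial>distr (extend M XA N K) N snd)) \<and>
    D_TV (extend M X'A N' K') N' snd (A \<circ> fst) \<le> D_TV (extend M XA N K) N snd (A \<circ> fst)"
proof -
  note M = assms(3) and X[measurable] = assms(4) and A[measurable] = assms(5) and Y[measurable] = assms(6)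
    and A_pos = assms(7) and h = assms(8) and f = assms(10) and K = assms(11)
  interpret M: prob_space M by (rule M)
  let ?L1 = "MX \<Otimes>\<^sub>M count_space {0, 1 :: nat}"
  let ?L = "restrict_space borel prob_simplex \<Otimes>\<^sub>M count_space {0, 1 :: nat} :: ((real ^ 'y) \<times> nat) measure"
  have XA[measurable]: "XA \<in> M \<rightarrow>\<^sub>M ?L1" unfolding XA_def by measurable
  \<comment> \<open>\<open>X'A\<close> factors through \<open>XA\<close>; this makes
    \<open>emeasure_label_extend\<close> applicable to the extension by \<open>Z'\<close> with
    \<open>XA\<close> as the finer variable.\<close>
  define \<phi> where "\<phi> v = (f v, snd v)" for v :: "'x \<times> nat"
  have fm[measurable]: "f \<in> ?L1 \<rightarrow>\<^sub>M restrict_space borel prob_simplex"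
    using f by (simp add: cond_dist_def)
  have \<phi>[measurable]: "\<phi> \<in> ?L1 \<rightarrow>\<^sub>M ?L" unfolding \<phi>_def by measurable
  have X'A: "X'A = (\<lambda>\<omega>. \<phi> (XA \<omega>))" by (simp add: X'A_def XA_def \<phi>_def)
  have X'Am[measurable]: "X'A \<in> M \<rightarrow>\<^sub>M ?L" unfolding X'A by measurable

  define P where "P = extend M XA N K"
  note ext = M XA K
  interpret P: prob_space P unfolding P_def by (rule prob_space_extend[OF ext])
  have fstP[measurable]: "fst \<in> P \<rightarrow>\<^sub>M M" and sndP[measurable]: "snd \<in> P \<rightarrow>\<^sub>M N"
    unfolding P_def by (rule measurable_fst_extend[OF ext], rule measurable_snd_extend[OF ext])
  have YP[measurable]: "Y \<circ> fst \<in> P \<rightarrow>\<^sub>M count_space UNIV" unfolding comp_def by measurable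

  obtain p0 where p0: "cond_dist P N snd (Y \<circ> fst) p0"
    using cond_dist_exists[OF P.prob_space_axioms sndP YP] by blast
  obtain e :: "real ^ 'y \<Rightarrow> real" and d where e[measurable]: "e \<in> borel_measurable borel" and e01: "\<And>x. e x \<in> {0..<1}"
    and d: "d \<in> borel \<rightarrow>\<^sub>M restrict_space borel prob_simplex"
    and de: "\<And>x. x \<in> prob_simplex \<Longrightarrow> d (e x) = x"
    using prob_simplex_borel_code by blast
  have p0m[measurable]: "p0 \<in> N \<rightarrow>\<^sub>M borel" by (rule cond_dist_measurable(1)[OF p0])
  have dm[measurable]: "d \<in> borel_measurable borel"
    using d by (simp add: measurable_restrict_space2_iff)
  have dp: "d (e (p0 z)) = p0 z" if "z \<in> space N" for z
    using p0 that by (intro de) (auto simp: cond_dist_def space_restrict_space dest: measurable_space)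
  \<comment> \<open>\<open>T\<close> is the real code of the posterior \<open>p0\<close>.
    \<open>Z'\<close> will imitate \<open>T (snd x)\<close>, and \<open>d\<close> turns it back into
    the posterior.\<close>
  define T where "T z = e (p0 z)" for z
  have T[measurable]: "T \<in> borel_measurable N" unfolding T_def by measurable

  have "(\<lambda>x. X'A (fst x)) \<in> P \<rightarrow>\<^sub>M ?L" "(\<lambda>x. T (snd x)) \<in> borel_measurable P" by measurable
  moreover have "T (snd x) \<in> {0..<1}" for x :: "'m \<times> 'z" unfolding T_def by (rule e01)
  ultimately obtain k where k[measurable]: "k \<in> ?L \<rightarrow>\<^sub>M prob_algebra borel"
    and kP: "\<And>B C. B \<in> sets ?L \<Longrightarrow> C \<in> sets borel \<Longrightarrow>
      emeasure P {x\<in>space P. X'A (fst x) \<in> B \<and> T (snd x) \<in> C}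
        = (\<integral>\<^sup>+s. emeasure (k s) C * indicator B s \<partial>distr P ?L (\<lambda>x. X'A (fst x)))"
    by (rule regular_conditional_distribution[OF P.prob_space_axioms]) auto
  have rk: "representation ?L borel k" using k by (simp add: representation_def)

  define P' where "P' = extend M X'A borel k"
  note ext' = M X'Am rk
  interpret P': prob_space P' unfolding P'_def by (rule prob_space_extend[OF ext'])
  have fstP'[measurable]: "fst \<in> P' \<rightarrow>\<^sub>M M" and sndP'[measurable]: "snd \<in> P' \<rightarrow>\<^sub>M borel"
    unfolding P'_def by (rule measurable_fst_extend[OF ext'], rule measurable_snd_extend[OF ext'])

  \<comment> \<open>The pair of \<open>X'A\<close> and \<open>Z'\<close> under \<open>P'\<close> is
    distributed like the pair of \<open>X'A\<close> and \<open>T (snd x)\<close> under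
    \<open>P\<close>. Integrating \<open>Z'\<close> out leaves \<open>k\<close> at
    \<open>X'A\<close>, whose law is the same on \<open>M\<close> and on \<open>P\<close>, and there
    \<open>k\<close> is the conditional law of \<open>T (snd x)\<close>.\<close>
  have law: "(\<integral>\<^sup>+x. g (X'A (fst x)) * indicator C (snd x) \<partial>P')
      = (\<integral>\<^sup>+x. g (X'A (fst x)) * indicator C (T (snd x)) \<partial>P)"
    if g[measurable]: "g \<in> borel_measurable ?L" and C[measurable]: "C \<in> sets borel" for g C
  proof -
    have [measurable]: "(\<lambda>s. emeasure (k s) C) \<in> borel_measurable ?L"
      by (rule measurable_emeasure_kernel[OF measurable_prob_algebraD[OF k]]) fact
    have "(\<integral>\<^sup>+x. g (X'A (fst x)) * indicator C (snd x) \<partial>P') = (\<integral>\<^sup>+\<omega>. g (X'A \<omega>) * emeasure (k (X'A \<omega>)) C \<partial>M)"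
      unfolding P'_def by (rule nn_integral_extend[OF ext']) measurable
    also have "\<dots> = (\<integral>\<^sup>+x. g (X'A (fst x)) * emeasure (k (X'A (fst x))) C \<partial>P)"
      unfolding P_def by (rule nn_integral_fst_extend[OF ext, symmetric]) measurable
    also have "\<dots> = (\<integral>\<^sup>+x. g (X'A (fst x)) * indicator C (T (snd x)) \<partial>P)"
    proof (rule nn_integral_conditional[where N = ?L, symmetric])
      fix B assume B[measurable]: "B \<in> sets ?L"
      have "(\<integral>\<^sup>+x. indicator B (X'A (fst x)) * indicator C (T (snd x)) \<partial>P)
          = (\<integral>\<^sup>+x. indicator {x\<in>space P. X'A (fst x) \<in> B \<and> T (snd x) \<in> C} x \<partial>P)"
        by (intro nn_integral_cong) (auto split: split_indicator)
      also have "\<dots> = emeasure P {x\<in>space P. X'A (fst x) \<in> B \<and> T (snd x) \<in> C}"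
        by (rule nn_integral_indicator) measurable
      also have "\<dots> = (\<integral>\<^sup>+x. indicator B (X'A (fst x)) * emeasure (k (X'A (fst x))) C \<partial>P)"
        unfolding kP[OF B C] mult.commute[of "indicator B _"] by (rule nn_integral_distr) measurable
      finally show "(\<integral>\<^sup>+x. indicator B (X'A (fst x)) * indicator C (T (snd x)) \<partial>P)
          = (\<integral>\<^sup>+x. indicator B (X'A (fst x)) * emeasure (k (X'A (fst x))) C \<partial>P)" .
    qed measurable
    finally show ?thesis .
  qed

  have law_snd: "distr P' borel snd = distr (distr P N snd) borel T"
  proof (rule measure_eqI)
    fix C assume "C \<in> sets (distr P' borel snd)"
    then have C[measurable]: "C \<in> sets borel" by simp
    have "emeasure (distr P' borel snd) C = (\<integral>\<^sup>+x. indicator C x \<partial>distr P' borel snd)" by simp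
    also have "\<dots> = (\<integral>\<^sup>+x. indicator C (snd x) \<partial>P')" by (rule nn_integral_distr) measurable
    also have "\<dots> = (\<integral>\<^sup>+x. indicator C (T (snd x)) \<partial>P)" using law[of "\<lambda>_. 1" C] by simp
    also have "\<dots> = (\<integral>\<^sup>+z. indicator C (T z) \<partial>distr P N snd)"
      by (rule nn_integral_distr[symmetric]) measurable
    also have "\<dots> = (\<integral>\<^sup>+x. indicator C x \<partial>distr (distr P N snd) borel T)"
      by (rule nn_integral_distr[symmetric]) measurable
    also have "\<dots> = emeasure (distr (distr P N snd) borel T) C" by simp
    finally show "emeasure (distr P' borel snd) C = emeasure (distr (distr P N snd) borel T) C" .
  qed simp

  \<comment> \<open>\<open>A\<close> is a component of \<open>X'A\<close>, so \<open>law\<close>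
    covers it directly.\<close>
  have law_A: "emeasure P' {x\<in>space P'. (A \<circ> fst) x = a \<and> snd x \<in> C}
      = emeasure P {x\<in>space P. (A \<circ> fst) x = a \<and> T (snd x) \<in> C}"
    if C[measurable]: "C \<in> sets borel" for a C
  proof -
    have sA: "snd (X'A \<omega>) = A \<omega>" for \<omega> by (simp add: X'A_def)
    have [measurable]: "A \<in> M \<rightarrow>\<^sub>M count_space UNIV" by (rule measurable_compose[OF A]) simp
    have "emeasure P' {x\<in>space P'. (A \<circ> fst) x = a \<and> snd x \<in> C}
        = (\<integral>\<^sup>+x. indicator {x\<in>space P'. (A \<circ> fst) x = a \<and> snd x \<in> C} x \<partial>P')"
      by (rule nn_integral_indicator[symmetric]) (simp, measurable)
    also have "\<dots> = (\<integral>\<^sup>+x. indicator {a} (snd (X'A (fst x))) * indicator C (snd x) \<partial>P')"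
      by (intro nn_integral_cong) (auto simp: sA split: split_indicator)
    also have "\<dots> = (\<integral>\<^sup>+x. indicator {a} (snd (X'A (fst x))) * indicator C (T (snd x)) \<partial>P)"
      by (rule law) (use C in \<open>auto intro!: measurable_compose[OF measurable_snd]\<close>)
    also have "\<dots> = (\<integral>\<^sup>+x. indicator {x\<in>space P. (A \<circ> fst) x = a \<and> T (snd x) \<in> C} x \<partial>P)"
      by (intro nn_integral_cong) (auto simp: sA split: split_indicator)
    also have "\<dots> = emeasure P {x\<in>space P. (A \<circ> fst) x = a \<and> T (snd x) \<in> C}"
      by (rule nn_integral_indicator) (simp, measurable)
    finally show ?thesis .
  qed

  \<comment> \<open>The label need not be a function of \<open>X'A\<close>, so it is first replaced
    by its conditional probability given \<open>XA\<close>. That probability is a coordinate of X',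
    to which \<open>law\<close> applies. The label is then restored on \<open>P\<close>, where the
    map from the finer variable is the identity.\<close>
  have law_Y: "emeasure P' {x\<in>space P'. Y (fst x) = y \<and> snd x \<in> C}
      = emeasure P {x\<in>space P. Y (fst x) = y \<and> snd x \<in> T -` C \<inter> space N}"
    if C[measurable]: "C \<in> sets borel" for y C
  proof -
    have fX: "f (XA \<omega>) = fst (X'A \<omega>)" for \<omega> by (simp add: X'A_def XA_def)
    have "(\<lambda>v :: (real ^ 'y) \<times> nat. fst v) \<in> ?L \<rightarrow>\<^sub>M borel"
      by (rule measurable_compose[OF measurable_fst]) (simp add: measurable_restrict_space1)
    then have gm: "(\<lambda>v. ennreal (fst v $ y)) \<in> borel_measurable ?L" by measurable
    have "emeasure P' {x\<in>space P'. Y (fst x) = y \<and> snd x \<in> C}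
        = (\<integral>\<^sup>+x. ennreal (f (XA (fst x)) $ y) * indicator C (snd x) \<partial>P')"
      unfolding P'_def by (rule emeasure_label_extend[OF M XA \<phi> X'A rk Y f C])
    also have "\<dots> = (\<integral>\<^sup>+x. ennreal (f (XA (fst x)) $ y) * indicator C (T (snd x)) \<partial>P)"
      unfolding fX by (rule law[OF gm C])
    also have "\<dots> = (\<integral>\<^sup>+x. ennreal (f (XA (fst x)) $ y) * indicator (T -` C \<inter> space N) (snd x) \<partial>P)"
      using measurable_space[OF sndP] by (intro nn_integral_cong) (auto split: split_indicator)
    also have "\<dots> = emeasure P {x\<in>space P. Y (fst x) = y \<and> snd x \<in> T -` C \<inter> space N}"
      unfolding P_def by (rule emeasure_label_extend[OF M XA measurable_ident _ K Y f, symmetric]) auto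
    finally show ?thesis .
  qed

  \<comment> \<open>This is P(Y | p(Z)) = p(Z): the equation for \<open>p0\<close>, restricted to
    sets that are preimages under \<open>T\<close>, involves \<open>p0\<close> only as
    \<open>d (T z)\<close>.\<close>
  have d_cond: "cond_dist P' borel snd (Y \<circ> fst) d"
    unfolding cond_dist_def
  proof (intro conjI d allI ballI)
    fix y and C :: "real set" assume C[measurable]: "C \<in> sets borel"
    have "measure P' {x\<in>space P'. snd x \<in> C \<and> (Y \<circ> fst) x = y}
        = measure P {x\<in>space P. snd x \<in> T -` C \<inter> space N \<and> (Y \<circ> fst) x = y}"
      using law_Y[OF C, of y] by (simp add: measure_def conj_commute)
    also have "\<dots> = (LINT z:T -` C \<inter> space N|distr P N snd. p0 z $ y)"
      using p0 measurable_sets[OF T C] unfolding cond_dist_def by blast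
    also have "\<dots> = (\<integral>z. indicator C (T z) *\<^sub>R d (T z) $ y \<partial>distr P N snd)"
      unfolding set_lebesgue_integral_def
      by (intro Bochner_Integration.integral_cong refl) (auto simp: T_def dp split: split_indicator)
    also have "\<dots> = (LINT v:C|distr P' borel snd. d v $ y)"
      unfolding law_snd set_lebesgue_integral_def by (subst integral_distr) auto
    finally show "measure P' {x\<in>space P'. snd x \<in> C \<and> (Y \<circ> fst) x = y} = (LINT v:C|distr P' borel snd. d v $ y)" .
  qed

  have hm: "h \<in> borel_measurable (restrict_space borel prob_simplex)"
    by (rule borel_measurable_continuous_on_restrict[OF h])
  have hp: "(\<lambda>v. h (p v)) \<in> borel_measurable N" if "cond_dist M N V Y p"
    for M :: "'c measure" and N :: "'d measure" and V Y p
    using that hm by (auto simp: cond_dist_def intro: measurable_compose)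

  \<comment> \<open>Arbitrary versions are exchanged for \<open>d\<close> and \<open>p0\<close>;
    then \<open>law_snd\<close> and \<open>d (T z) = p0 z\<close> identify the two
    integrals.\<close>
  have entropy: "(\<integral>z'. h (p' z') \<partial>distr P' borel snd) = (\<integral>z. h (p z) \<partial>distr P N snd)"
    if p: "cond_dist P N snd (Y \<circ> fst) p" and p': "cond_dist P' borel snd (Y \<circ> fst) p'" for p p'
  proof -
    have "(\<integral>z'. h (p' z') \<partial>distr P' borel snd) = (\<integral>z'. h (d z') \<partial>distr P' borel snd)"
      using cond_dist_AE_unique[OF P'.prob_space_axioms sndP' p' d_cond] hp[OF p'] hp[OF d_cond]
      by (intro integral_cong_AE) auto
    also have "\<dots> = (\<integral>z. h (d (T z)) \<partial>distr P N snd)"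
      unfolding law_snd using hp[OF d_cond] by (intro integral_distr) auto
    also have "\<dots> = (\<integral>z. h (p0 z) \<partial>distr P N snd)"
      by (intro Bochner_Integration.integral_cong refl) (simp add: T_def dp)
    also have "\<dots> = (\<integral>z. h (p z) \<partial>distr P N snd)"
      using cond_dist_AE_unique[OF P.prob_space_axioms sndP p0 p] hp[OF p] hp[OF p0]
      by (intro integral_cong_AE) auto
    finally show ?thesis .
  qed

  have A'[measurable]: "A \<in> M \<rightarrow>\<^sub>M count_space UNIV" by (rule measurable_compose[OF A]) simp
  have sA: "{x\<in>space P. (A \<circ> fst) x = a} \<in> sets P" "{x\<in>space P'. (A \<circ> fst) x = a} \<in> sets P'" for a
    by (simp, measurable)+
  have A_posP: "0 < measure P {x\<in>space P. (A \<circ> fst) x = a}" if a: "a \<in> {0, 1}" for a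
  proof -
    have "emeasure P {x\<in>space P. (A \<circ> fst) x = a} = (\<integral>\<^sup>+x. indicator {\<omega>\<in>space M. A \<omega> = a} (fst x) \<partial>P)"
      unfolding nn_integral_indicator[OF sA(1), symmetric] using measurable_space[OF fstP]
      by (intro nn_integral_cong) (auto split: split_indicator)
    also have "\<dots> = emeasure M {\<omega>\<in>space M. A \<omega> = a}"
      unfolding P_def by (subst nn_integral_fst_extend[OF ext]) auto
    finally show ?thesis using A_pos[OF a] by (simp add: measure_def)
  qed
  \<comment> \<open>Given \<open>A\<close>, \<open>Z'\<close> is distributed like the function
    \<open>T\<close> of \<open>Z\<close>, so data processing bounds its distance.\<close>
  have "cond_law P' borel snd (A \<circ> fst) a = cond_law P borel (\<lambda>x. T (snd x)) (A \<circ> fst) a" for a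
    by (rule cond_law_cong[OF sndP' measurable_compose[OF sndP T] sA(2,1) law_A])
  then have "D_TV P' borel snd (A \<circ> fst) = D_TV P borel (\<lambda>x. T (snd x)) (A \<circ> fst)"
    by (simp add: D_TV_def)
  also have "\<dots> \<le> D_TV P N snd (A \<circ> fst)"
    by (rule D_TV_compose_le[OF sndP P.prob_space_axioms T A_posP])
  finally have tv: "D_TV P' borel snd (A \<circ> fst) \<le> D_TV P N snd (A \<circ> fst)" .
  show ?thesis
    using rk entropy tv unfolding P_def P'_def
    by (intro exI[of _ borel] exI[of _ k]) auto
qed

end
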